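(* Let $A$ be a finite alphabet of colors and $C$ a sentence over $A$. Then $$H_C=\sum_J K_{J,C}\,\mathfrak{S}_J,$$ where the sum runs over sentences $J$ with $|J|=|C|$ and $K_{J,C}$ is the number of colored immaculate tableaux of shape $J$ and type $C$.
   Context: Words are finite sequences of colors, $\cdot$ is concatenation; a sentence is a finite sequence $I=(w_1,\dots,w_k)$ of nonempty words; $|I|$ is its number of letters, $\ell(I)=k$; $Q\preceq S$ means $S$ is obtained from $Q$ by concatenating adjacent words. Let $x_{a,i}$ ($a\in A$, $i\ge1$) be variables subject only to $x_{a,i}x_{b,j}=x_{b,j}x_{a,i}$ for $i\ne j$; $x_{w,i}=x_{c_1,i}\cdots x_{c_r,i}$. $M_I=\sum_{j_1<\dots<j_k}x_{w_1,j_1}\cdots x_{w_k,j_k}$, $M_\emptyset=1$; $QSym_A=\mathrm{span}\{M_I\}$ with power-series product. $NSym_A$ is the free associative algebra on $H_w$ ($w$ nonempty words), $H_I=H_{w_1}\cdots H_{w_k}$, paired with $QSym_A$ by $\langle H_I,M_J\rangle=\delta_{I,J}$. For $M\in QSym_A$, $M^{\perp_r}$ is the linear map on $NSym_A$ with $\langle M^{\perp_r}(H),G\rangle=\langle H,GM\rangle$ for all $G$. For a nonempty word $v$, $\mathbb{B}_v(f)=\sum_u\sum_{Q}(-1)^{\ell(Q)}H_{(v\cdot u)}\big(\sum_{S\succeq Q}M^{\perp_r}_S(f)\big)$, where $u$ runs over all words (the empty word contributing only $Q=\emptyset$ with $M^{\perp_r}_\emptyset=\mathrm{id}$), $Q=(q_1,\dots,q_i)$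 over sentences with $q_i\cdots q_1=u$, $S$ over coarsenings of $Q$. The colored immaculate function of $J=(v_1,\dots,v_h)$ is $\mathfrak{S}_J=\mathbb{B}_{v_1}\cdots\mathbb{B}_{v_h}(1)$. For $J=(w_1,\dots,w_k)$ the colored composition diagram has $k$ left-justified rows (row 1 on top), row $i$ with $|w_i|$ boxes colored in order by the letters of $w_i$. A colored immaculate tableau of shape $J$ fills its boxes with positive integers weakly increasing left to right in rows and strictly increasing top to bottom in the first column; its type is the weak sentence $(u_1,\dots,u_m)$ where $u_i$ is the word of colors of the boxes containing $i$, read from the lowest row to the highest row, left to right within rows. *)

theory Defs
  imports Complex_Main "HOL-Library.Poly_Mapping"
begin

text \<open>Colors are the elements of a finite type; words are lists of colors.\<close>

typedef 'a sentence = "{I :: 'a list list. [] \<notin> set I}"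
  morphisms words Sentence
  by (rule exI[of _ "[]"]) simp

setup_lifting type_definition_sentence

instantiation sentence :: (type) monoid_add
begin

lift_definition zero_sentence :: "'a sentence" is "[]" by simp

lift_definition plus_sentence :: "'a sentence \<Rightarrow> 'a sentence \<Rightarrow> 'a sentence" is "(@)" by simp

instance by standard (transfer, simp)+

end

definition letters :: "'a sentence \<Rightarrow> nat"
  where "letters I = length (concat (words I))"

definition len :: "'a sentence \<Rightarrow> nat"
  where "len I = length (words I)"

definition coarsening :: "'a sentence \<Rightarrow> 'a sentence \<Rightarrow> bool"  (infix \<open>\<preceq>\<close> 50)
  where "Q \<preceq> S \<longleftrightarrow>
    (\<exists>P :: 'a list list list. [] \<notin> set P \<and> concat P = words Q \<and> map concat P = words S)"


subsection \<open>Partially commutative monomials and power series\<close>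

text \<open>The pair \<open>(a, i)\<close> stands for the variable \<open>x\<^bsub>a,i\<^esub>\<close>.  Monomials are the elements of
  the monoid generated by the variables subject only to the commutations of variables with
  distinct indices.\<close>

inductive commutation_eq :: "('a \<times> nat) list \<Rightarrow> ('a \<times> nat) list \<Rightarrow> bool" where
  swap: "i \<noteq> j \<Longrightarrow> commutation_eq (p @ [(a, i), (b, j)] @ q) (p @ [(b, j), (a, i)] @ q)"
| refl: "commutation_eq p p"
| sym: "commutation_eq p q \<Longrightarrow> commutation_eq q p"
| trans: "commutation_eq p q \<Longrightarrow> commutation_eq q r \<Longrightarrow> commutation_eq p r"

lemma commutation_eq_append_left: "commutation_eq p q \<Longrightarrow> commutation_eq (r @ p) (r @ q)"
proof (induction rule: commutation_eq.induct)
  case (swap i j p a b q)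
  then show ?case using commutation_eq.swap[of i j "r @ p" a b q] by simp
qed (blast intro: commutation_eq.intros)+

lemma commutation_eq_append_right: "commutation_eq p q \<Longrightarrow> commutation_eq (p @ r) (q @ r)"
proof (induction rule: commutation_eq.induct)
  case (swap i j p a b q)
  then show ?case using commutation_eq.swap[of i j p a b "q @ r"] by simp
qed (blast intro: commutation_eq.intros)+

quotient_type 'a monom = "('a \<times> nat) list" / commutation_eq
  by (rule equivpI; intro reflpI sympI transpI) (blast intro: commutation_eq.intros)+

instantiation monom :: (type) monoid_mult
begin

lift_definition one_monom :: "'a monom" is "[]" .

lift_definition times_monom :: "'a monom \<Rightarrow> 'a monom \<Rightarrow> 'a monom" is "(@)"
  by (meson commutation_eq.trans commutation_eq_append_left commutation_eq_append_right)

instance by standard (transfer, simp add: commutation_eq.refl)+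

end

lift_definition var :: "'a \<Rightarrow> nat \<Rightarrow> 'a monom" is "\<lambda>a i. [(a, i)]" .

definition word_monom :: "'a list \<Rightarrow> nat \<Rightarrow> 'a monom"
  where "word_monom w i = prod_list (map (\<lambda>c. var c i) w)"

text \<open>A power series is given by its coefficients.  A monomial has only finitely many
  factorizations into two monomials, so the sum in the product is finite.\<close>

type_synonym ('a, 'k) pseries = "'a monom \<Rightarrow> 'k"

definition ps_mult :: "('a, 'k::comm_ring_1) pseries \<Rightarrow> ('a, 'k) pseries \<Rightarrow> ('a, 'k) pseries"
    (infixl \<open>\<odot>\<close> 70)
  where "F \<odot> G = (\<lambda>m. \<Sum>(p, q) \<in> {(p, q). p * q = m}. F p * G q)"

text \<open>The coefficient of a monomial \<open>m\<close> in \<open>M\<^sub>I\<close> counts the summands equal to \<open>m\<close>, i.e. the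
  index sequences \<open>1 \<le> j\<^sub>1 < \<dots> < j\<^sub>k\<close> whose monomial is \<open>m\<close>.\<close>

definition M :: "'a sentence \<Rightarrow> ('a, 'k::comm_ring_1) pseries"
  where "M I = (\<lambda>m. of_nat (card {js :: nat list.
    length js = len I \<and> sorted_wrt (<) js \<and> (\<forall>j \<in> set js. 1 \<le> j) \<and>
    prod_list (map2 word_monom (words I) js) = m}))"

definition M_comb :: "('a sentence \<Rightarrow>\<^sub>0 'k::comm_ring_1) \<Rightarrow> ('a, 'k) pseries"
  where "M_comb c = (\<lambda>m. \<Sum>J \<in> Poly_Mapping.keys c. Poly_Mapping.lookup c J * M J m)"

definition QSym :: "('a, 'k::comm_ring_1) pseries set"
  where "QSym = range M_comb"


subsection \<open>The free algebra and its pairing with the quasisymmetric functions\<close>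

text \<open>Sentences under concatenation form the free monoid on the nonempty words, so the free
  associative algebra on the \<open>H\<^sub>w\<close> is the monoid algebra of sentences, with the convolution
  product of \<^type>\<open>poly_mapping\<close>.\<close>

type_synonym ('a, 'k) nsym = "'a sentence \<Rightarrow>\<^sub>0 'k"

definition H :: "'a sentence \<Rightarrow> ('a, 'k::comm_ring_1) nsym"
  where "H I = Poly_Mapping.single I 1"

definition nsym_scale :: "'k::comm_ring_1 \<Rightarrow> ('a, 'k) nsym \<Rightarrow> ('a, 'k) nsym"
  where "nsym_scale c f = Poly_Mapping.map ((*) c) f"

text \<open>The bilinear extension of \<open>\<langle>H\<^sub>I, M\<^sub>J\<rangle> = \<delta>\<^bsub>I,J\<^esub>\<close>; the coordinates of \<open>G\<close> in the \<open>M\<^sub>J\<close> are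
  unique because the \<open>M\<^sub>J\<close> are linearly independent.\<close>

definition M_coords :: "('a, 'k::comm_ring_1) pseries \<Rightarrow> ('a sentence \<Rightarrow>\<^sub>0 'k)"
  where "M_coords G = (THE c. G = M_comb c)"

definition pairing :: "('a, 'k::comm_ring_1) nsym \<Rightarrow> ('a, 'k) pseries \<Rightarrow> 'k"
  where "pairing f G =
    (\<Sum>I \<in> Poly_Mapping.keys f. Poly_Mapping.lookup f I * Poly_Mapping.lookup (M_coords G) I)"

definition perp :: "('a, 'k::comm_ring_1) pseries \<Rightarrow> ('a, 'k) nsym \<Rightarrow> ('a, 'k) nsym"
  where "perp F = (THE T. module_hom nsym_scale nsym_scale T \<and>
    (\<forall>f. \<forall>G \<in> QSym. pairing (T f) G = pairing f (G \<odot> F)))"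


subsection \<open>Colored immaculate functions\<close>

text \<open>Only finitely many \<open>u\<close> contribute to the outer sum, since \<open>M\<^sub>S\<^sup>\<bottom> f = 0\<close> once \<open>S\<close> has
  more letters than the degree of \<open>f\<close>.  The operator is meant for nonempty \<open>v\<close>.\<close>

definition bernstein :: "'a list \<Rightarrow> ('a, 'k::comm_ring_1) nsym \<Rightarrow> ('a, 'k) nsym"
  where "bernstein v f = Sum_any (\<lambda>u :: 'a list.
    \<Sum>Q \<in> {Q. concat (rev (words Q)) = u}.
      (- 1) ^ len Q * H (Sentence [v @ u]) * (\<Sum>S \<in> {S. Q \<preceq> S}. perp (M S) f))"

definition immaculate :: "'a sentence \<Rightarrow> ('a, 'k::comm_ring_1) nsym"
  where "immaculate J = foldr bernstein (words J) 1"


subsection \<open>Colored immaculate tableaux\<close>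

text \<open>A filling is the list of its rows, top row first.\<close>

definition immaculate_tableau :: "'a sentence \<Rightarrow> nat list list \<Rightarrow> bool"
  where "immaculate_tableau J T \<longleftrightarrow>
    map length T = map length (words J) \<and>
    (\<forall>r \<in> set T. sorted r \<and> (\<forall>n \<in> set r. 1 \<le> n)) \<and>
    sorted_wrt (<) (map hd T)"

definition color_word :: "'a sentence \<Rightarrow> nat list list \<Rightarrow> nat \<Rightarrow> 'a list"
  where "color_word J T i =
    concat (map (\<lambda>(w, r). [c. (c, n) \<leftarrow> zip w r, n = i]) (rev (zip (words J) T)))"

text \<open>The length of the type is the largest entry of the tableau.\<close>

definition tableau_type :: "'a sentence \<Rightarrow> nat list list \<Rightarrow> 'a list list"
  where "tableau_type J T =
    map (color_word J T) [1..<Suc (Max (insert 0 (set (concat T))))]"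

definition K :: "'a sentence \<Rightarrow> 'a sentence \<Rightarrow> nat"
  where "K J C = card {T. immaculate_tableau J T \<and> tableau_type J T = words C}"

end

theory Submission
  imports Defs
begin

text \<open>Reading a monomial as a finitely supported family of words (one for each index) turns
  \<open>M\<^sub>S\<^sup>\<bottom>\<close> into an explicit operator on \<open>H\<^sub>I\<close>: cut every word of \<open>I\<close> into a prefix and a suffix,
  keep the prefixes, and require the nonempty suffixes to spell \<open>S\<close>.  A sign-reversing
  cancellation then gives the commutation rule
  \<open>B\<^sub>v(f) H\<^sub>w = \<Sum> B\<^bsub>v\<cdot>u\<^esub>(f H\<^bsub>w'\<^esub>)\<close>, the sum running over all factorizations \<open>w = w'\<cdot>u\<close>.  Iterating it along
  the rows of \<open>J\<close> expands \<open>\<SS>\<^sub>J H\<^sub>w\<close> over all ways to append pieces of \<open>w\<close> to the ends of the rows and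
  below the last row, the pieces spelling \<open>w\<close> from the bottom row to the top row; these are the
  ways to add the boxes with a new largest entry to a tableau.  The theorem follows by induction
  on the length of \<open>C\<close>.\<close>

subsection \<open>Sentences\<close>

text \<open>Creation operators add rows on the left, while a further word of \<open>C\<close>
  multiplies on the right. So \<open>H_w\<close> has to pass through every operator before it
  reaches the constant 1, where \<open>1 * H_w = B_w(1)\<close> leaves at most one new row.
  Strictness in the first column allows exactly that, since two new rows would start with the same
  entry.

  \<open>M_coords\<close> and \<open>perp\<close> are definite descriptions, so nothing can be
  computed before uniqueness is known. It comes from the supports of the \<open>M_I\<close>: they
  are nonempty and pairwise disjoint, because a monomial determines the one sentence that it spells.
  The adjoint exists because the product with \<open>M_S\<close> is again a finite combination of
  the \<open>M_I\<close>, with explicit coefficients.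

  Cutting words produces empty pieces, which a sentence cannot contain. Prefixes and suffixes are
  therefore kept as aligned lists of possibly empty words, and \<open>sentence_of\<close> discards
  the empty ones only when a basis element is formed.\<close>

abbreviation drop_empty :: "'b list list \<Rightarrow> 'b list list"
  where "drop_empty \<equiv> filter (\<lambda>w. w \<noteq> [])"

definition sentence_of :: "'a list list \<Rightarrow> 'a sentence"
  where "sentence_of X = Sentence (drop_empty X)"

lemma words_nonempty [simp]: "[] \<notin> set (words I)"
  using words[of I] by simp

lemma words_sentence_of [simp]: "words (sentence_of X) = drop_empty X"
  by (simp add: sentence_of_def Sentence_inverse)

lemma drop_empty_id: "[] \<notin> set X \<Longrightarrow> drop_empty X = X"
  by (auto simp: filter_id_conv)

lemma sentence_of_words [simp]: "sentence_of (words I) = I"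
  by (simp add: sentence_of_def words_inverse drop_empty_id)

lemma words_zero [simp]: "words 0 = []"
  by (rule zero_sentence.rep_eq)

lemma words_plus [simp]: "words (I + J) = words I @ words J"
  by (rule plus_sentence.rep_eq)

lemma sentence_of_Nil [simp]: "sentence_of [] = 0"
  by (metis sentence_of_words words_zero)

lemma sentence_of_append [simp]: "sentence_of (X @ Y) = sentence_of X + sentence_of Y"
  by (simp flip: words_inject)

lemma sentence_of_empty_word [simp]: "sentence_of [[]] = 0"
  by (simp flip: words_inject)

lemma concat_drop_empty [simp]: "concat (drop_empty X) = concat X"
  by (induction X) auto

lemma letters_sentence_of: "letters (sentence_of X) = length (concat X)"
  by (simp add: letters_def)

lemma letters_zero [simp]: "letters 0 = 0"
  by (simp add: letters_def)

lemma letters_plus [simp]: "letters (I + J) = letters I + letters J"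
  by (simp add: letters_def)

lemma len_zero [simp]: "len 0 = 0"
  by (simp add: len_def)

lemma len_plus [simp]: "len (I + J) = len I + len J"
  by (simp add: len_def)

lemma length_le_length_concat: "[] \<notin> set X \<Longrightarrow> length X \<le> length (concat X)"
proof (induction X)
  case (Cons w X)
  then have "length w \<ge> 1" by (cases w) auto
  with Cons show ?case by simp
qed simp

text \<open>No word is empty, so the number of letters bounds the number of words as well as their
  lengths. The later finiteness claims for sets of sentences reduce to this one.\<close>

lemma finite_letters_le: "finite {I :: 'a::finite sentence. letters I \<le> n}"
proof -
  let ?W = "{w :: 'a list. set w \<subseteq> UNIV \<and> length w \<le> n}"
  have "{I :: 'a sentence. letters I \<le> n} \<subseteq> sentence_of ` {X. set X \<subseteq> ?W \<and> length X \<le> n}"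
  proof
    fix I :: "'a sentence" assume "I \<in> {I. letters I \<le> n}"
    then have "length (concat (words I)) \<le> n" by (simp add: letters_def)
    moreover have "length w \<le> length (concat (words I))" if "w \<in> set (words I)" for w
      using that by (auto simp: length_concat intro: member_le_sum_list)
    ultimately have "words I \<in> {X. set X \<subseteq> ?W \<and> length X \<le> n}"
      using length_le_length_concat[OF words_nonempty, of I] by force
    then show "I \<in> sentence_of ` {X. set X \<subseteq> ?W \<and> length X \<le> n}"
      by (intro image_eqI[where x = "words I"]) simp_all
  qed
  moreover have "finite ?W" by (rule finite_lists_length_le) simp
  ultimately show ?thesis
    by (blast intro: finite_subset finite_imageI finite_lists_length_le)
qed

lemma coarsening_concat: "Q \<preceq> S \<Longrightarrow> concat (words S) = concat (words Q)"
proof -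
  have "concat (concat P) = concat (map concat P)" for P :: "'a list list list"
    by (induction P) auto
  then show "Q \<preceq> S \<Longrightarrow> concat (words S) = concat (words Q)"
    unfolding coarsening_def by metis
qed

lemma coarsening_letters: "Q \<preceq> S \<Longrightarrow> letters S = letters Q"
  by (simp add: letters_def coarsening_concat)

subsection \<open>Monomials as families of words\<close>

text \<open>A swap exchanges letters with different indices only, so the subsequence of a fixed
  index is an invariant of the class. These invariants embed the monomials into a product of free
  monoids, one for each index; injectivity is \<open>monom_eqI\<close>.\<close>

lift_definition word_at :: "'a monom \<Rightarrow> nat \<Rightarrow> 'a list"
  is "\<lambda>l i. map fst (filter (\<lambda>x. snd x = i) l)"
proof -
  fix l l' :: "('a \<times> nat) list" assume "commutation_eq l l'"
  then show "(\<lambda>i. map fst (filter (\<lambda>x. snd x = i) l)) = (\<lambda>i. map fst (filter (\<lambda>x. snd x = i) l'))"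
    by induction (auto simp: fun_eq_iff)
qed

lemma word_at_one [simp]: "word_at 1 i = []"
  by transfer simp

lemma word_at_mult [simp]: "word_at (p * q) i = word_at p i @ word_at q i"
  by transfer simp

lemma word_at_var: "word_at (var a j) i = (if i = j then [a] else [])"
  by transfer simp

lemma word_at_word_monom: "word_at (word_monom w j) i = (if i = j then w else [])"
  by (induction w) (auto simp: word_monom_def word_at_var)

lemma commutation_eq_move_front:
  assumes "\<forall>y \<in> set a. snd y \<noteq> snd x"
  shows "commutation_eq (a @ x # b) (x # a @ b)"
  using assms
proof (induction a)
  case (Cons y a)
  then have "commutation_eq ([y] @ a @ x # b) ([y] @ x # a @ b)"
    by (intro commutation_eq_append_left) auto
  moreover have "commutation_eq ([] @ [(fst y, snd y), (fst x, snd x)] @ (a @ b))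
      ([] @ [(fst x, snd x), (fst y, snd y)] @ (a @ b))"
    using Cons.prems by (intro commutation_eq.swap) auto
  ultimately show ?case by (auto intro: commutation_eq.trans)
qed (simp add: commutation_eq.refl)

text \<open>The first letter \<open>x\<close> of \<open>l\<close> is also the first letter of its
  index in \<open>l'\<close>. Everything before it there has another index, so \<open>x\<close> can
  be moved to the front and cancelled.\<close>

lemma commutation_eq_if_filters_eq:
  assumes "\<And>i. filter (\<lambda>x. snd x = i) l = filter (\<lambda>x. snd x = i) l'"
  shows "commutation_eq l l'"
  using assms
proof (induction l arbitrary: l')
  case Nil
  then have "filter (\<lambda>x. snd x = i) l' = []" for i by simp
  then have "l' = []" by (metis (mono_tags) filter_empty_conv list.set_intros(1) neq_Nil_conv)
  then show ?case by (simp add: commutation_eq.refl)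
next
  case (Cons x l)
  have "filter (\<lambda>y. snd y = snd x) l' = x # filter (\<lambda>y. snd y = snd x) l"
    using Cons.prems[of "snd x"] by simp
  then obtain a b where ab: "l' = a @ x # b" "\<forall>y \<in> set a. snd y \<noteq> snd x"
    by (auto simp: filter_eq_Cons_iff)
  have "filter (\<lambda>y. snd y = i) l = filter (\<lambda>y. snd y = i) (a @ b)" for i
  proof (cases "i = snd x")
    case True
    moreover have "filter (\<lambda>y. snd y = snd x) a = []" using ab(2) by (simp add: filter_empty_conv)
    ultimately show ?thesis using Cons.prems[of i] ab(1) by simp
  next
    case False
    then show ?thesis using Cons.prems[of i] ab(1) by simp
  qed
  then have "commutation_eq l (a @ b)" by (rule Cons.IH)
  then have "commutation_eq ([x] @ l) ([x] @ a @ b)" by (rule commutation_eq_append_left)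
  then have "commutation_eq (x # l) (x # a @ b)" by simp
  then show ?case
    unfolding ab(1) by (rule commutation_eq.trans[OF _ commutation_eq.sym[OF commutation_eq_move_front[OF ab(2)]]])
qed

lemma monom_eqI:
  assumes "\<And>i. word_at p i = word_at q i"
  shows "p = q"
  using assms
proof (transfer fixing: )
  fix l l' :: "('a \<times> nat) list"
  assume *: "\<And>i. map fst (filter (\<lambda>x. snd x = i) l) = map fst (filter (\<lambda>x. snd x = i) l')"
  have "filter (\<lambda>x. snd x = i) k = map (\<lambda>a. (a, i)) (map fst (filter (\<lambda>x. snd x = i) k))"
    for i and k :: "('a \<times> nat) list"
    by (induction k) auto
  with * show "commutation_eq l l'" by (metis commutation_eq_if_filters_eq)
qed

definition indices :: "'a monom \<Rightarrow> nat set"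
  where "indices m = {i. word_at m i \<noteq> []}"

definition index_list :: "'a monom \<Rightarrow> nat list"
  where "index_list m = sorted_list_of_set (indices m)"

definition shape :: "'a monom \<Rightarrow> 'a list list"
  where "shape m = map (word_at m) (index_list m)"

lemma finite_indices [simp]: "finite (indices m)"
  unfolding indices_def
proof (transfer)
  fix l :: "('a \<times> nat) list"
  have "{i. map fst (filter (\<lambda>x. snd x = i) l) \<noteq> []} \<subseteq> snd ` set l"
    by (auto simp: filter_empty_conv)
  then show "finite {i. map fst (filter (\<lambda>x. snd x = i) l) \<noteq> []}"
    by (rule finite_subset) simp
qed

lemma set_index_list [simp]: "set (index_list m) = indices m"
  by (simp add: index_list_def)

lemma index_list_sorted [simp]: "sorted (index_list m)" "distinct (index_list m)"
  by (simp_all add: index_list_def)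

lemma shape_nonempty [simp]: "[] \<notin> set (shape m)"
  by (auto simp: shape_def indices_def)

text \<open>\<open>L\<close> may contain indices at which \<open>p\<close> has no letter: a factor
  of \<open>m\<close> is later read along the index list of \<open>m\<close>.\<close>

lemma shape_eq:
  assumes "sorted L" "distinct L" "indices p \<subseteq> set L"
  shows "shape p = drop_empty (map (word_at p) L)"
proof -
  have "index_list p = filter (\<lambda>i. word_at p i \<noteq> []) L"
    using assms by (intro sorted_distinct_set_unique) (auto simp: indices_def intro: sorted_filter[where f = id, simplified])
  then show ?thesis by (simp add: shape_def filter_map o_def)
qed

lemma word_at_prod_list_not_in:
  assumes "i \<notin> set js"
  shows "word_at (prod_list (map2 word_monom ws js)) i = []"
  using assms
proof (induction js arbitrary: ws)
  case (Cons j js)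
  then show ?case by (cases ws) (auto simp: word_at_word_monom)
qed simp

lemma map_word_at_prod_list:
  assumes "length ws = length js" "distinct js"
  shows "map (word_at (prod_list (map2 word_monom ws js))) js = ws"
  using assms
proof (induction ws js rule: list_induct2)
  case (Cons w ws j js)
  let ?p = "prod_list (map2 word_monom ws js)"
  have "word_at (word_monom w j * ?p) i = word_at ?p i" if "i \<in> set js" for i
    using that Cons.prems by (auto simp: word_at_word_monom)
  then have "map (word_at (word_monom w j * ?p)) js = map (word_at ?p) js"
    by (intro map_cong) simp_all
  moreover have "word_at (word_monom w j * ?p) j = w"
    using Cons.prems by (simp add: word_at_word_monom word_at_prod_list_not_in)
  ultimately show ?case using Cons
    by (simp only: list.map zip_Cons_Cons prod.case prod_list.Cons distinct.simps)
qed simp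

lemma prod_list_shape:
  assumes "distinct L" "indices m \<subseteq> set L" "map (word_at m) L = ws"
  shows "prod_list (map2 word_monom ws L) = m"
proof (rule monom_eqI)
  fix i
  show "word_at (prod_list (map2 word_monom ws L)) i = word_at m i"
  proof (cases "i \<in> set L")
    case True
    have "map (word_at (prod_list (map2 word_monom ws L))) L = map (word_at m) L"
      using assms by (subst map_word_at_prod_list) auto
    with True show ?thesis by simp
  next
    case False
    with assms(2) have "word_at m i = []" by (auto simp: indices_def)
    with False show ?thesis by (simp add: word_at_prod_list_not_in)
  qed
qed

text \<open>All words of \<open>I\<close> are nonempty, so a summand determines its index sequence
  as the sorted list of the indices that occur, and no monomial arises twice. Index 0 is a value of
  the type but is excluded from the sequences in \<open>M\<close>.\<close>

lemma M_eq:
  "M I m = (if 0 \<notin> indices m \<and> shape m = words I then 1 else 0)"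
proof -
  let ?A = "{js :: nat list. length js = len I \<and> sorted_wrt (<) js \<and> (\<forall>j \<in> set js. 1 \<le> j) \<and>
    prod_list (map2 word_monom (words I) js) = m}"
  have *: "js = index_list m \<and> 0 \<notin> indices m \<and> shape m = words I" if "js \<in> ?A" for js
  proof -
    from that have js: "length (words I) = length js" "sorted js" "distinct js" "0 \<notin> set js"
      and m: "m = prod_list (map2 word_monom (words I) js)"
      by (auto simp: len_def strict_sorted_iff)
    have w: "map (word_at m) js = words I"
      unfolding m by (rule map_word_at_prod_list) (use js in auto)
    have "indices m = set js"
    proof
      show "indices m \<subseteq> set js"
        using word_at_prod_list_not_in[of _ js "words I"] unfolding indices_def m by blast
      show "set js \<subseteq> indices m"
      proof
        fix i assume "i \<in> set js"
        then have "word_at m i \<in> set (words I)" using w by (metis imageI image_set)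
        then have "word_at m i \<noteq> []" using words_nonempty[of I] by metis
        then show "i \<in> indices m" by (simp add: indices_def)
      qed
    qed
    then have "js = index_list m"
      using js(2,3) by (intro sorted_distinct_set_unique) simp_all
    moreover have "0 \<notin> indices m" using js(4) \<open>indices m = set js\<close> by simp
    ultimately show ?thesis using w by (simp add: shape_def)
  qed
  show ?thesis
  proof (cases "0 \<notin> indices m \<and> shape m = words I")
    case True
    then have "prod_list (map2 word_monom (words I) (index_list m)) = m"
      by (intro prod_list_shape) (auto simp: shape_def)
    moreover have "length (index_list m) = len I"
      using True by (metis len_def length_map shape_def)
    ultimately have "index_list m \<in> ?A"
      using True by (auto simp: strict_sorted_iff Suc_le_eq intro: gr0I)
    then have "?A = {index_list m}" using * by blast
    then have "card ?A = 1" by simp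
    with True show ?thesis unfolding M_def by simp
  next
    case False
    then have "?A = {}" using * by blast
    then have "card ?A = 0" by (simp only: card.empty)
    with False show ?thesis unfolding M_def by auto
  qed
qed

lemma M_comb_eq:
  fixes c :: "'a sentence \<Rightarrow>\<^sub>0 'k::comm_ring_1"
  shows "M_comb c m = (if 0 \<in> indices m then 0 else Poly_Mapping.lookup c (sentence_of (shape m)))"
proof (cases "0 \<in> indices m")
  case False
  have "shape m = words J \<longleftrightarrow> J = sentence_of (shape m)" for J
    by (metis drop_empty_id sentence_of_words shape_nonempty words_sentence_of)
  with False have "M J m = (if sentence_of (shape m) = J then 1 else (0::'k))" for J
    by (auto simp: M_eq)
  then have "M_comb c m = (\<Sum>J \<in> Poly_Mapping.keys c.
      if sentence_of (shape m) = J then Poly_Mapping.lookup c J else 0)"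
    unfolding M_comb_def by (intro sum.cong) auto
  with False show ?thesis by (simp add: in_keys_iff)
qed (simp add: M_comb_def M_eq)

lemma ex_monom_with_shape:
  fixes I :: "'a sentence"
  obtains m :: "'a monom" where "0 \<notin> indices m" "sentence_of (shape m) = I"
proof
  let ?js = "[1..<Suc (len I)]"
  let ?m = "prod_list (map2 word_monom (words I) ?js)"
  have ind: "indices ?m \<subseteq> set ?js"
    using word_at_prod_list_not_in[of _ ?js "words I"] unfolding indices_def by blast
  then show "0 \<notin> indices ?m" by auto
  have "map (word_at ?m) ?js = words I"
    by (rule map_word_at_prod_list) (simp_all add: len_def del: upt_Suc)
  then have "shape ?m = words I"
    using shape_eq[OF _ _ ind] by (simp add: drop_empty_id del: upt_Suc)
  then show "sentence_of (shape ?m) = I" by simp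
qed

text \<open>This is linear independence: a monomial spelling \<open>I\<close> with positive indices
  sees the coefficient of \<open>M I\<close> and no other.\<close>

lemma M_coords_M_comb [simp]:
  fixes c :: "'a sentence \<Rightarrow>\<^sub>0 'k::comm_ring_1"
  shows "M_coords (M_comb c) = c"
  unfolding M_coords_def
proof (rule the_equality)
  fix d :: "'a sentence \<Rightarrow>\<^sub>0 'k" assume eq: "M_comb c = M_comb d"
  show "d = c"
  proof (rule poly_mapping_eqI)
    fix I
    obtain m :: "'a monom" where "0 \<notin> indices m" "sentence_of (shape m) = I" by (rule ex_monom_with_shape)
    then show "Poly_Mapping.lookup d I = Poly_Mapping.lookup c I"
      using fun_cong[OF eq, of m] by (simp add: M_comb_eq)
  qed
qed simp

subsection \<open>Products of quasisymmetric functions\<close>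

text \<open>Empty pieces are kept, so that each prefix and suffix stays at the position of the word
  it was cut from.\<close>

definition splittings :: "'b list list \<Rightarrow> ('b list list \<times> 'b list list) set"
  where "splittings X = {(P, R). length P = length X \<and> length R = length X \<and> map2 (@) P R = X}"

lemma splittings_Nil [simp]: "splittings [] = {([], [])}"
  by (auto simp: splittings_def)

lemma splittings_snoc:
  "splittings (X @ [w]) =
    (\<lambda>((P, R), k). (P @ [take k w], R @ [drop k w])) ` (splittings X \<times> {..length w})"
  (is "?L = ?h ` ?R")
proof
  have "(P @ [take k w], R @ [drop k w]) \<in> ?L" if "(P, R) \<in> splittings X" for P R k
  proof -
    have "length P = length R" using that by (simp add: splittings_def)
    then show ?thesis using that by (simp add: splittings_def zip_append)
  qed
  then show "?h ` ?R \<subseteq> ?L" by (simp add: image_subset_iff case_prod_unfold)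
  show "?L \<subseteq> ?h ` ?R"
  proof (clarify)
    fix P R assume *: "(P, R) \<in> ?L"
    then have "P \<noteq> []" "R \<noteq> []" by (auto simp: splittings_def)
    then obtain P' p R' r where PR: "P = P' @ [p]" "R = R' @ [r]"
      by (metis rev_exhaust)
    with * have "length P' = length R'" by (simp add: splittings_def)
    with * PR have "(P', R') \<in> splittings X" "w = p @ r" by (simp_all add: splittings_def zip_append)
    then show "(P, R) \<in> ?h ` ?R"
      unfolding PR by (intro image_eqI[where x = "((P', R'), length p)"]) auto
  qed
qed

lemma finite_splittings [simp]: "finite (splittings X)"
  by (induction X rule: rev_induct) (auto simp: splittings_snoc)

lemma sum_splittings_snoc:
  "(\<Sum>(P, R) \<in> splittings (X @ [w]). g P R) =
    (\<Sum>k\<le>length w. \<Sum>(P, R) \<in> splittings X. g (P @ [take k w]) (R @ [drop k w]))"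
proof -
  have "inj_on (\<lambda>((P, R), k). (P @ [take k w], R @ [drop k w])) (splittings X \<times> {..length w})"
    by (auto simp: inj_on_def) (metis length_take min.absorb2)
  then have "(\<Sum>(P, R) \<in> splittings (X @ [w]). g P R) =
      (\<Sum>((P, R), k) \<in> splittings X \<times> {..length w}. g (P @ [take k w]) (R @ [drop k w]))"
    by (simp add: splittings_snoc sum.reindex o_def case_prod_unfold)
  also have "\<dots> = (\<Sum>k\<le>length w. \<Sum>(P, R) \<in> splittings X. g (P @ [take k w]) (R @ [drop k w]))"
    by (subst sum.swap) (simp add: sum.cartesian_product case_prod_unfold)
  finally show ?thesis .
qed

lemma splittings_length:
  "(P, R) \<in> splittings X \<Longrightarrow> length (concat P) + length (concat R) = length (concat X)"
proof (induction X arbitrary: P R rule: rev_induct)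
  case (snoc w X)
  then show ?case by (fastforce simp: splittings_snoc)
qed simp

text \<open>Since \<open>word_at\<close> is multiplicative, a factorization of \<open>m\<close> cuts
  the word at each index independently: \<open>p\<close> receives the prefixes and \<open>q\<close>
  the suffixes. A piece that is empty does not show in the shape of its factor.\<close>

lemma sum_factorizations:
  "(\<Sum>(p, q) \<in> {(p, q). p * q = m}. g (shape p) (shape q)) =
    (\<Sum>(P, R) \<in> splittings (shape m). g (drop_empty P) (drop_empty R))"
proof -
  let ?L = "index_list m"
  let ?i = "\<lambda>P. prod_list (map2 word_monom P ?L)"
  let ?j = "\<lambda>p. map (word_at p) ?L"
  have sub: "indices p \<subseteq> set ?L" "indices q \<subseteq> set ?L" if "p * q = m" for p q
    using that unfolding set_index_list by (auto simp: indices_def)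
  have ij: "?i (?j p) = p" "?i (?j q) = q" if "p * q = m" for p q
    using sub[OF that] by (intro prod_list_shape; simp)+
  have ji: "?j (?i P) = P" if "length P = length (shape m)" for P
    using that by (intro map_word_at_prod_list) (auto simp: shape_def)
  have sh: "shape p = drop_empty (?j p)" "shape q = drop_empty (?j q)" if "p * q = m" for p q
    using sub[OF that] by (intro shape_eq; simp)+
  have m: "?i P * ?i R = m" if "(P, R) \<in> splittings (shape m)" for P R
  proof (rule monom_eqI)
    fix k
    show "word_at (?i P * ?i R) k = word_at m k"
    proof (cases "k \<in> indices m")
      case True
      have len: "length P = length (shape m)" "length R = length (shape m)"
        and app: "map2 (@) P R = shape m"
        using that by (auto simp: splittings_def)
      have "?j (?i P * ?i R) = map2 (@) (?j (?i P)) (?j (?i R))"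
        by (simp add: map2_map_map)
      also have "\<dots> = ?j m"
        using app by (simp only: ji[OF len(1)] ji[OF len(2)] shape_def)
      finally show ?thesis using True by simp
    next
      case False
      then show ?thesis by (simp add: word_at_prod_list_not_in) (simp add: indices_def)
    qed
  qed
  have split: "(?j p, ?j q) \<in> splittings (shape m)" if "p * q = m" for p q
    unfolding that[symmetric] by (simp add: splittings_def shape_def map2_map_map)
  show ?thesis
  proof (rule sum.reindex_bij_witness
      [where i = "\<lambda>(P, R). (?i P, ?i R)" and j = "\<lambda>(p, q). (?j p, ?j q)"])
    fix x assume "x \<in> {(p, q). p * q = m}"
    then obtain p q where x: "x = (p, q)" "p * q = m" by blast
    show "(case case x of (p, q) \<Rightarrow> (?j p, ?j q) of (P, R) \<Rightarrow> (?i P, ?i R)) = x"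
      using ij[OF x(2)] unfolding x(1) prod.case by simp
    show "(case x of (p, q) \<Rightarrow> (?j p, ?j q)) \<in> splittings (shape m)"
      using split[OF x(2)] unfolding x(1) prod.case .
    show "(case case x of (p, q) \<Rightarrow> (?j p, ?j q) of (P, R) \<Rightarrow> g (drop_empty P) (drop_empty R)) =
        (case x of (p, q) \<Rightarrow> g (shape p) (shape q))"
      unfolding x(1) prod.case sh[OF x(2)] ..
  next
    fix y assume y: "y \<in> splittings (shape m)"
    then obtain P R where PR: "y = (P, R)" "(P, R) \<in> splittings (shape m)" by (cases y) simp
    have len: "length P = length (shape m)" "length R = length (shape m)"
      using PR(2) by (auto simp: splittings_def)
    show "(case case y of (P, R) \<Rightarrow> (?i P, ?i R) of (p, q) \<Rightarrow> (?j p, ?j q)) = y"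
      unfolding PR(1) prod.case ji[OF len(1)] ji[OF len(2)] ..
    show "(case y of (P, R) \<Rightarrow> (?i P, ?i R)) \<in> {(p, q). p * q = m}"
      using m[OF PR(2)] unfolding PR(1) by simp
  qed
qed

subsection \<open>The adjoint of multiplication by a monomial quasisymmetric function\<close>

lemma sentence_of_eq_iff: "sentence_of X = I \<longleftrightarrow> drop_empty X = words I"
  by (simp flip: words_inject)

lemma sentence_of_drop_empty [simp]: "sentence_of (drop_empty X) = sentence_of X"
  by (simp add: sentence_of_eq_iff)

lemma lookup_nsym_scale [simp]:
  "Poly_Mapping.lookup (nsym_scale c f) x = c * Poly_Mapping.lookup f x"
  by (simp add: nsym_scale_def Poly_Mapping.map.rep_eq when_def)

lemma module_nsym_scale: "module nsym_scale"
  by unfold_locales (simp_all add: poly_mapping_eq_iff fun_eq_iff lookup_add algebra_simps)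

interpretation nsym: module nsym_scale
  by (rule module_nsym_scale)

lemma nsym_scale_mult_left:
  fixes f g :: "('a, 'k::comm_ring_1) nsym"
  shows "nsym_scale c f * g = nsym_scale c (f * g)"
proof -
  have scale: "nsym_scale c f = Poly_Mapping.single 0 c * f" for f :: "('a, 'k) nsym"
    by (simp add: nsym_scale_def mult_map_scale_conv_mult)
  show ?thesis by (simp add: scale mult.assoc)
qed

lemma H_zero [simp]: "H 0 = 1"
  by (simp add: H_def)

lemma H_plus: "H (I + J) = H I * H J"
  by (simp add: H_def mult_single)

section \<open>Linear extension from the basis of the \<open>H I\<close>\<close>

definition linear_extension :: "('a sentence \<Rightarrow> ('a, 'k::comm_ring_1) nsym) \<Rightarrow> ('a, 'k) nsym \<Rightarrow> ('a, 'k) nsym"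
  where "linear_extension g f =
    (\<Sum>I \<in> Poly_Mapping.keys f. nsym_scale (Poly_Mapping.lookup f I) (g I))"

lemma linear_extension_superset:
  assumes "finite A" "Poly_Mapping.keys f \<subseteq> A"
  shows "linear_extension g f = (\<Sum>I \<in> A. nsym_scale (Poly_Mapping.lookup f I) (g I))"
  unfolding linear_extension_def
  by (rule sum.mono_neutral_left) (use assms in \<open>auto simp: in_keys_iff\<close>)

lemma linear_extension_add:
  "linear_extension g (f + f') = linear_extension g f + linear_extension g f'"
proof -
  let ?A = "Poly_Mapping.keys f \<union> Poly_Mapping.keys f'"
  have "Poly_Mapping.keys (f + f') \<subseteq> ?A" by (rule Poly_Mapping.keys_add)
  then show ?thesis
    by (simp add: linear_extension_superset[of ?A] lookup_add nsym.scale_left_distrib sum.distrib)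
qed

lemma linear_extension_scale:
  "linear_extension g (nsym_scale c f) = nsym_scale c (linear_extension g f)"
proof -
  have "Poly_Mapping.keys (nsym_scale c f) \<subseteq> Poly_Mapping.keys f"
    by (auto simp: in_keys_iff)
  then show ?thesis
    by (simp add: linear_extension_superset[of "Poly_Mapping.keys f"] nsym.scale_sum_right)
qed

lemma linear_extension_H [simp]: "linear_extension g (H I) = g I"
  by (simp add: linear_extension_def H_def)

lemma nsym_linear_induct [case_names H scale add]:
  assumes "\<And>I. P (H I)" "\<And>c f. P f \<Longrightarrow> P (nsym_scale c f)" "\<And>f g. P f \<Longrightarrow> P g \<Longrightarrow> P (f + g)"
  shows "P (f :: ('a, 'k::comm_ring_1) nsym)"
proof -
  have "f = linear_extension H f"
    by (rule poly_mapping_eqI)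
      (simp add: linear_extension_def lookup_sum H_def lookup_single when_def if_distrib in_keys_iff cong: if_cong)
  moreover have "P 0" using assms(2)[OF assms(1), of 0] by simp
  then have "P (\<Sum>I \<in> A. nsym_scale (c I) (H I))" for A c
    by (induction A rule: infinite_finite_induct) (auto intro: assms)
  ultimately show ?thesis unfolding linear_extension_def by metis
qed

section \<open>The pairing and the explicit adjoint\<close>

lemma pairing_M_comb:
  "pairing f (M_comb c) =
    (\<Sum>J \<in> Poly_Mapping.keys c. Poly_Mapping.lookup f J * Poly_Mapping.lookup c J)"
  unfolding pairing_def M_coords_M_comb
  by (rule sum.mono_neutral_cong) (auto simp: in_keys_iff)

lemma pairing_H [simp]: "pairing (H I) (M_comb c) = Poly_Mapping.lookup c I"
  by (simp add: pairing_def H_def)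

lemma pairing_zero [simp]: "pairing 0 G = 0"
  by (simp add: pairing_def)

lemma pairing_sum: "pairing (\<Sum>x \<in> X. h x) (M_comb c) = (\<Sum>x \<in> X. pairing (h x) (M_comb c))"
  by (simp add: pairing_M_comb lookup_sum sum_distrib_right sum.swap[of _ X])

lemma pairing_scale: "pairing (nsym_scale a f) (M_comb c) = a * pairing f (M_comb c)"
  by (simp add: pairing_M_comb sum_distrib_left mult.assoc)

lemma pairing_linear_extension:
  "pairing (linear_extension g f) (M_comb c) =
    (\<Sum>I \<in> Poly_Mapping.keys f. Poly_Mapping.lookup f I * pairing (g I) (M_comb c))"
  by (simp add: linear_extension_def pairing_sum pairing_scale)

text \<open>A predicate on the removed suffixes, instead of a single sentence, lets the same
  operator also express the sum of the adjoints of \<open>M S\<close> over all coarsenings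
  \<open>S\<close> of \<open>Q\<close>.\<close>

definition skew_H :: "('a sentence \<Rightarrow> bool) \<Rightarrow> 'a sentence \<Rightarrow> ('a, 'k::comm_ring_1) nsym"
  where "skew_H \<phi> I = (\<Sum>(P, R) \<in> splittings (words I).
    if \<phi> (sentence_of R) then H (sentence_of P) else 0)"

definition skew :: "('a sentence \<Rightarrow> bool) \<Rightarrow> ('a, 'k::comm_ring_1) nsym \<Rightarrow> ('a, 'k) nsym"
  where "skew \<phi> = linear_extension (skew_H \<phi>)"

text \<open>The coefficient at \<open>I\<close> is read off any monomial spelling \<open>I\<close>:
  the left factor takes the prefixes and \<open>M S\<close> the suffixes. The support is finite
  because letter counts add, so \<open>I\<close> has at most \<open>letters S\<close> letters more
  than some sentence in the support of \<open>c\<close>.\<close>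

lemma M_comb_times_M:
  fixes c :: "'a::finite sentence \<Rightarrow>\<^sub>0 'k::comm_ring_1"
  obtains d where "M_comb c \<odot> M S = M_comb d"
    and "\<And>I. Poly_Mapping.lookup d I = (\<Sum>(P, R) \<in> splittings (words I).
      if sentence_of R = S then Poly_Mapping.lookup c (sentence_of P) else 0)"
proof
  define e where "e I = (\<Sum>(P, R) \<in> splittings (words I).
      if sentence_of R = S then Poly_Mapping.lookup c (sentence_of P) else 0)" for I
  let ?n = "\<Sum>I \<in> Poly_Mapping.keys c. letters I"
  have "letters I \<le> ?n + letters S" if "e I \<noteq> 0" for I
  proof -
    have "\<exists>(P, R) \<in> splittings (words I). sentence_of R = S \<and>
        Poly_Mapping.lookup c (sentence_of P) \<noteq> 0"
    proof (rule ccontr)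
      assume "\<not> ?thesis"
      then have "e I = 0" unfolding e_def by (intro sum.neutral) auto
      with that show False by simp
    qed
    then obtain P R where PR: "(P, R) \<in> splittings (words I)" "sentence_of R = S"
        "Poly_Mapping.lookup c (sentence_of P) \<noteq> 0"
      by blast
    then have "letters (sentence_of P) \<le> ?n"
      by (intro member_le_sum) (auto simp: in_keys_iff)
    with splittings_length[OF PR(1)] PR(2) show ?thesis
      by (auto simp: letters_sentence_of letters_def[of I])
  qed
  then have fin: "finite {I. e I \<noteq> 0}"
    by (intro finite_subset[OF _ finite_letters_le[of "?n + letters S"]]) auto
  show e: "Poly_Mapping.lookup (Abs_poly_mapping e) I = (\<Sum>(P, R) \<in> splittings (words I).
      if sentence_of R = S then Poly_Mapping.lookup c (sentence_of P) else 0)" for I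
    using fin by (simp add: lookup_Abs_poly_mapping e_def)
  show "M_comb c \<odot> M S = M_comb (Abs_poly_mapping e)"
  proof
    fix m :: "'a monom"
    have indices_mult: "indices (p * q) = indices p \<union> indices q" for p q :: "'a monom"
      by (auto simp: indices_def)
    show "(M_comb c \<odot> M S) m = M_comb (Abs_poly_mapping e) m"
    proof (cases "0 \<in> indices m")
      case True
      then have "M_comb c p * M S q = 0" if "p * q = m" for p q
        using that indices_mult[of p q] by (auto simp: M_comb_eq M_eq)
      with True show ?thesis
        by (auto simp: ps_mult_def M_comb_eq intro!: sum.neutral)
    next
      case False
      define g where "g P R = Poly_Mapping.lookup c (sentence_of P) *
        (if R = words S then 1 else 0)" for P R
      have "M_comb c p * M S q = g (shape p) (shape q)" if "p * q = m" for p q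
        using that False indices_mult[of p q] by (auto simp: M_comb_eq M_eq g_def)
      then have "(M_comb c \<odot> M S) m = (\<Sum>(p, q) \<in> {(p, q). p * q = m}. g (shape p) (shape q))"
        unfolding ps_mult_def by (intro sum.cong) auto
      also have "\<dots> = (\<Sum>(P, R) \<in> splittings (shape m). g (drop_empty P) (drop_empty R))"
        by (rule sum_factorizations)
      also have "\<dots> = M_comb (Abs_poly_mapping e) m"
        using False
        by (auto simp: M_comb_eq e drop_empty_id g_def sentence_of_eq_iff intro!: sum.cong)
      finally show ?thesis .
    qed
  qed
qed

lemma pairing_skew:
  fixes f :: "('a::finite, 'k::comm_ring_1) nsym"
  shows "pairing (skew (\<lambda>R. R = S) f) (M_comb c) = pairing f (M_comb c \<odot> M S)"
proof -
  obtain d where d: "M_comb c \<odot> M S = M_comb d"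
    "\<And>I. Poly_Mapping.lookup d I = (\<Sum>(P, R) \<in> splittings (words I).
      if sentence_of R = S then Poly_Mapping.lookup c (sentence_of P) else 0)"
    using M_comb_times_M[of c S] by blast
  have "pairing (skew_H (\<lambda>R. R = S) I) (M_comb c) = Poly_Mapping.lookup d I" for I
    unfolding d(2) skew_H_def pairing_sum by (intro sum.cong) auto
  then show ?thesis
    unfolding skew_def pairing_linear_extension d(1) by (simp add: pairing_def)
qed

lemma module_hom_skew: "module_hom nsym_scale nsym_scale (skew \<phi>)"
  by unfold_locales (simp_all add: skew_def linear_extension_add linear_extension_scale)

lemma perp_M:
  "perp (M S :: ('a::finite, 'k::comm_ring_1) pseries) = skew (\<lambda>R. R = S)"
  unfolding perp_def
proof (rule the_equality)
  show "module_hom nsym_scale nsym_scale (skew (\<lambda>R. R = S) :: ('a, 'k) nsym \<Rightarrow> _) \<and>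
    (\<forall>f. \<forall>G \<in> QSym. pairing (skew (\<lambda>R. R = S) f) G = pairing f (G \<odot> (M S :: ('a, 'k) pseries)))"
    by (auto simp: module_hom_skew QSym_def pairing_skew)
next
  fix T :: "('a, 'k) nsym \<Rightarrow> ('a, 'k) nsym"
  assume T: "module_hom nsym_scale nsym_scale T \<and>
    (\<forall>f. \<forall>G \<in> QSym. pairing (T f) G = pairing f (G \<odot> M S))"
  show "T = skew (\<lambda>R. R = S)"
  proof (intro ext poly_mapping_eqI)
    fix f J
    \<comment> \<open>Pairing with a single \<open>M J\<close> extracts the coefficient at
      \<open>J\<close>, so the adjointness condition fixes every coefficient of
      \<open>T f\<close>.\<close>
    let ?G = "M_comb (Poly_Mapping.single J 1) :: ('a, 'k) pseries"
    have coeff: "pairing g ?G = Poly_Mapping.lookup g J" for g :: "('a, 'k) nsym"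
      by (simp add: pairing_M_comb)
    have "pairing (T f) ?G = pairing (skew (\<lambda>R. R = S) f) ?G"
      using T by (simp add: pairing_skew QSym_def)
    then show "Poly_Mapping.lookup (T f) J = Poly_Mapping.lookup (skew (\<lambda>R. R = S) f) J"
      by (simp add: coeff)
  qed
qed

subsection \<open>The creation operators\<close>

lemma skew_add: "skew \<phi> (f + g) = skew \<phi> f + skew \<phi> g"
  by (simp add: skew_def linear_extension_add)

lemma skew_scale: "skew \<phi> (nsym_scale c f) = nsym_scale c (skew \<phi> f)"
  by (simp add: skew_def linear_extension_scale)

lemma skew_apply_H: "skew \<phi> (H I) = skew_H \<phi> I"
  by (simp add: skew_def)

lemma finite_coarsenings: "finite {S :: 'a::finite sentence. Q \<preceq> S}"
  by (rule finite_subset[OF _ finite_letters_le[of "letters Q"]]) (auto simp: coarsening_letters)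

text \<open>The suffixes of a given splitting spell exactly one sentence, so summing over
  \<open>S\<close> merely tests whether that sentence is a coarsening of \<open>Q\<close>.\<close>

lemma sum_perp_coarsenings:
  fixes f :: "('a::finite, 'k::comm_ring_1) nsym"
  shows "(\<Sum>S \<in> {S. Q \<preceq> S}. perp (M S) f) = skew (\<lambda>S. Q \<preceq> S) f"
  unfolding perp_M
proof (induction f rule: nsym_linear_induct)
  case (H I)
  have "(\<Sum>S \<in> {S. Q \<preceq> S}. skew_H (\<lambda>R. R = S) I) =
      (\<Sum>(P, R) \<in> splittings (words I). \<Sum>S \<in> {S. Q \<preceq> S}.
        if sentence_of R = S then H (sentence_of P) else (0 :: ('a, 'k) nsym))"
    unfolding skew_H_def by (subst sum.swap) (simp add: case_prod_unfold)
  also have "\<dots> = skew_H (\<lambda>S. Q \<preceq> S) I"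
    unfolding skew_H_def by (intro sum.cong) (auto simp: finite_coarsenings)
  finally show ?case by (simp add: skew_apply_H)
next
  case (scale c f)
  then show ?case by (simp add: skew_scale flip: nsym.scale_sum_right)
next
  case (add f g)
  then show ?case by (simp add: skew_add sum.distrib)
qed

lemma skew_eq_0:
  fixes f :: "('a, 'k::comm_ring_1) nsym"
  assumes "\<And>I. I \<in> Poly_Mapping.keys f \<Longrightarrow> letters I \<le> n"
    and "\<And>R. \<phi> R \<Longrightarrow> n < letters R"
  shows "skew \<phi> f = 0"
proof -
  have "skew_H \<phi> I = (0 :: ('a, 'k) nsym)" if "letters I \<le> n" for I
    unfolding skew_H_def
  proof (intro sum.neutral ballI, clarify)
    fix P R assume "(P, R) \<in> splittings (words I)"
    then have "letters (sentence_of R) \<le> n"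
      using splittings_length[of P R "words I"] that by (simp add: letters_sentence_of letters_def)
    then show "(if \<phi> (sentence_of R) then H (sentence_of P) else 0) = 0"
      using assms(2)[of "sentence_of R"] by auto
  qed
  then show ?thesis unfolding skew_def linear_extension_def
    by (intro sum.neutral) (simp add: assms(1))
qed

abbreviation rev_concat :: "'a sentence \<Rightarrow> 'a list"
  where "rev_concat Q \<equiv> concat (rev (words Q))"

lemma length_rev_concat: "length (rev_concat Q) = letters Q"
  by (simp add: letters_def length_concat rev_map[symmetric] sum_list_rev)

text \<open>The word \<open>u\<close> is determined by \<open>Q\<close>, and skewing by more letters
  than \<open>f\<close> has gives 0, so the double sum becomes one finite sum over \<open>Q\<close>.
  Any bound \<open>n\<close> is allowed, so that several elements can share one range of
  summation.\<close>

lemma bernstein_eq: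
  fixes f :: "('a::finite, 'k::comm_ring_1) nsym"
  assumes "v \<noteq> []" and n: "\<And>I. I \<in> Poly_Mapping.keys f \<Longrightarrow> letters I \<le> n"
  shows "bernstein v f = (\<Sum>Q \<in> {Q. letters Q \<le> n}.
    (- 1) ^ len Q * H (sentence_of [v @ rev_concat Q]) * skew (\<lambda>S. Q \<preceq> S) f)"
proof -
  define h where "h Q = (- 1) ^ len Q * H (sentence_of [v @ rev_concat Q]) * skew (\<lambda>S. Q \<preceq> S) f"
    for Q
  have h0: "h Q = 0" if "n < letters Q" for Q
  proof -
    have "skew (\<lambda>S. Q \<preceq> S) f = 0"
      by (rule skew_eq_0[OF n]) (use that in \<open>auto dest: coarsening_letters\<close>)
    then show ?thesis by (simp add: h_def)
  qed
  let ?U = "{u :: 'a list. length u \<le> n}"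
  have fin: "finite ?U" using finite_lists_length_le[of "UNIV :: 'a set" n] by simp
  have sent: "Sentence [v @ u] = sentence_of [v @ u]" for u
    using assms(1) by (simp add: sentence_of_def)
  have "bernstein v f = Sum_any (\<lambda>u. sum h {Q. rev_concat Q = u})"
    unfolding bernstein_def sum_perp_coarsenings sent h_def by (intro Sum_any.cong sum.cong) auto
  also have "\<dots> = (\<Sum>u \<in> ?U. sum h {Q. rev_concat Q = u})"
  proof (rule Sum_any.expand_superset[OF fin])
    show "{u. sum h {Q. rev_concat Q = u} \<noteq> 0} \<subseteq> ?U"
    proof (clarify, rule ccontr)
      fix u assume u: "sum h {Q. rev_concat Q = u} \<noteq> 0" "\<not> length u \<le> n"
      have "h Q = 0" if "rev_concat Q = u" for Q
        using u(2) that length_rev_concat[of Q] by (intro h0) simp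
      then have "sum h {Q. rev_concat Q = u} = 0" by (intro sum.neutral) simp
      with u(1) show False by simp
    qed
  qed
  also have "\<dots> = (\<Sum>u \<in> ?U. sum h {Q \<in> {Q. letters Q \<le> n}. rev_concat Q = u})"
    by (intro sum.cong refl arg_cong[where f = "sum h"]) (auto simp flip: length_rev_concat)
  also have "\<dots> = sum h {Q. letters Q \<le> n}"
    by (rule sum.group) (use fin finite_letters_le in \<open>auto simp only: length_rev_concat\<close>)
  finally show ?thesis by (simp add: h_def)
qed

lemma obtain_letters_bound:
  obtains n where "\<And>I. I \<in> Poly_Mapping.keys f \<Longrightarrow> letters I \<le> n"
  by (rule that[of "\<Sum>I \<in> Poly_Mapping.keys f. letters I"]) (auto intro: member_le_sum)

lemma bernstein_add:
  fixes f g :: "('a::finite, 'k::comm_ring_1) nsym"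
  assumes v: "v \<noteq> []"
  shows "bernstein v (f + g) = bernstein v f + bernstein v g"
proof -
  obtain m n where m: "\<And>I. I \<in> Poly_Mapping.keys f \<Longrightarrow> letters I \<le> m"
    and n: "\<And>I. I \<in> Poly_Mapping.keys g \<Longrightarrow> letters I \<le> n"
    by (metis obtain_letters_bound)
  have "letters I \<le> m + n" if "I \<in> Poly_Mapping.keys (f + g)" for I
    using that Poly_Mapping.keys_add[of f g] m n by (meson UnE le_add1 le_add2 order_trans subsetD)
  moreover have "letters I \<le> m + n" if "I \<in> Poly_Mapping.keys f" for I
    using m[OF that] by simp
  moreover have "letters I \<le> m + n" if "I \<in> Poly_Mapping.keys g" for I
    using n[OF that] by simp
  ultimately show ?thesis
    by (simp add: bernstein_eq[OF v, where n = "m + n"] skew_add distrib_left sum.distrib)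
qed

lemma bernstein_sum:
  fixes h :: "'b \<Rightarrow> ('a::finite, 'k::comm_ring_1) nsym"
  assumes "v \<noteq> []"
  shows "bernstein v (\<Sum>x \<in> X. h x) = (\<Sum>x \<in> X. bernstein v (h x))"
proof -
  have "bernstein v (0 :: ('a, 'k) nsym) = 0"
    using bernstein_add[OF assms, of 0 "0 :: ('a, 'k) nsym"] by simp
  then show ?thesis
    by (induction X rule: infinite_finite_induct) (simp_all add: bernstein_add[OF assms])
qed

lemma zero_coarsening_zero: "0 \<preceq> 0"
  by (simp add: coarsening_def)

lemma letters_eq_0 [simp]: "letters I = 0 \<longleftrightarrow> I = 0"
proof
  assume "letters I = 0"
  then have "words I = []"
    using length_le_length_concat[OF words_nonempty, of I] unfolding letters_def by (metis le_zero_eq length_0_conv)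
  then show "I = 0" by (simp flip: words_inject)
qed simp

lemma bernstein_one:
  assumes "v \<noteq> []"
  shows "bernstein v (1 :: ('a::finite, 'k::comm_ring_1) nsym) = H (sentence_of [v])"
proof -
  have "bernstein v (1 :: ('a, 'k) nsym) = (\<Sum>Q \<in> {Q. letters Q \<le> 0}.
    (- 1) ^ len Q * H (sentence_of [v @ rev_concat Q]) * skew (\<lambda>S. Q \<preceq> S) 1)"
    by (rule bernstein_eq[OF assms]) simp
  also have "\<dots> = H (sentence_of [v]) * skew (\<lambda>S. 0 \<preceq> S) 1"
  proof -
    have "{Q :: 'a sentence. letters Q \<le> 0} = {0}" by auto
    then show ?thesis by simp
  qed
  also have "skew (\<lambda>S. 0 \<preceq> S) 1 = (1 :: ('a, 'k) nsym)"
    using skew_apply_H[of "\<lambda>S. 0 \<preceq> S" 0, where ?'b = 'k]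
    by (simp add: skew_H_def zero_coarsening_zero)
  finally show ?thesis by simp
qed

subsection \<open>The right Pieri rule\<close>

abbreviation H_word :: "'a list \<Rightarrow> ('a, 'k::comm_ring_1) nsym"
  where "H_word w \<equiv> H (sentence_of [w])"

definition cuts :: "'a sentence \<Rightarrow> 'a list \<Rightarrow> ('a sentence \<times> 'a sentence) set"
  where "cuts Q q = {(Q1, Q2). Q = Q1 + Q2 \<and> concat (words Q2) = q}"

lemma concat_words_eq_Nil: "concat (words Q) = [] \<longleftrightarrow> Q = 0"
  using letters_eq_0[of Q] by (simp add: letters_def)

text \<open>Of two tails of \<open>Q\<close> one extends the other. If both spell \<open>q\<close>,
  the extra words spell the empty word, and there are none because words of a sentence are
  nonempty.\<close>

lemma cuts_unique:
  assumes "x \<in> cuts Q q" "y \<in> cuts Q q"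
  shows "x = y"
proof -
  obtain A B C D where xy: "x = (A, B)" "y = (C, D)" by (meson surj_pair)
  have *: "us = []" if "X = Y @ us" "us @ Z = W" "concat Z = concat W" "[] \<notin> set X"
    for us X Y Z W :: "'a list list"
  proof -
    have "concat W = concat us @ concat Z" using that(2) by (metis concat_append)
    then have "concat us = []" using that(3) by simp
    then show ?thesis using that(1,4) by (cases us) auto
  qed
  have eq: "words A @ words B = words C @ words D" and c: "concat (words B) = concat (words D)"
    using assms xy by (auto simp: cuts_def simp flip: words_plus)
  have "words A = words C \<and> words B = words D"
    using eq unfolding append_eq_append_conv2
  proof (elim exE disjE conjE)
    fix us assume us: "words A = words C @ us" "us @ words B = words D"
    then have "us = []" using c words_nonempty[of A] by (rule *)
    with us show ?thesis by simp
  next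
    fix us assume us: "words A @ us = words C" "words B = us @ words D"
    have "us = []" by (rule *[OF us(1)[symmetric] us(2)[symmetric] c[symmetric] words_nonempty])
    with us show ?thesis by simp
  qed
  then show ?thesis using xy by (simp add: words_inject)
qed

text \<open>The words of \<open>Q\<close> that merge into the last word \<open>q\<close> form a tail
  of \<open>Q\<close>. For \<open>q = []\<close> the word disappears in \<open>sentence_of\<close>,
  and the only matching tail is the empty one.\<close>

lemma coarsening_snoc:
  "Q \<preceq> R + sentence_of [q] \<longleftrightarrow> (\<exists>(Q1, Q2) \<in> cuts Q q. Q1 \<preceq> R)"
proof (cases "q = []")
  case True
  have "cuts Q q = {(Q, 0)}" by (auto simp: cuts_def True concat_words_eq_Nil simp del: concat_eq_Nil_conv)
  then show ?thesis by (simp add: True)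
next
  case q: False
  show ?thesis
  proof
    assume "Q \<preceq> R + sentence_of [q]"
    then obtain P where P: "[] \<notin> set P" "concat P = words Q" "map concat P = words R @ [q]"
      using q by (auto simp: coarsening_def)
    then obtain P1 p where P1: "P = P1 @ [p]" "map concat P1 = words R" "concat p = q"
      by (auto simp: map_eq_append_conv)
    then have words: "words Q = concat P1 @ p" using P(2) by simp
    then have ne: "[] \<notin> set (concat P1)" "[] \<notin> set p"
      using words_nonempty[of Q] by (simp_all only: set_append Un_iff not_False_eq_True de_Morgan_disj)
    have w1: "words (sentence_of (concat P1)) = concat P1" "words (sentence_of p) = p"
      using ne by (simp_all only: words_sentence_of drop_empty_id not_False_eq_True)
    have "(sentence_of (concat P1), sentence_of p) \<in> cuts Q q"
      using P1(3) w1 words by (auto simp: cuts_def simp flip: words_inject simp del: words_sentence_of)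
    moreover have "sentence_of (concat P1) \<preceq> R"
      unfolding coarsening_def w1 using P(1) P1 by (intro exI[of _ P1]) auto
    ultimately show "\<exists>(Q1, Q2) \<in> cuts Q q. Q1 \<preceq> R" by blast
  next
    assume "\<exists>(Q1, Q2) \<in> cuts Q q. Q1 \<preceq> R"
    then obtain Q1 Q2 P where Q: "Q = Q1 + Q2" "concat (words Q2) = q"
      and P: "[] \<notin> set P" "concat P = words Q1" "map concat P = words R"
      by (auto simp: cuts_def coarsening_def)
    have "words Q2 \<noteq> []" using Q(2) q by auto
    with P Q q show "Q \<preceq> R + sentence_of [q]"
      unfolding coarsening_def by (intro exI[of _ "P @ [words Q2]"]) auto
  qed
qed

lemma sum_if_subsingleton:
  assumes "\<And>x y. x \<in> X \<Longrightarrow> y \<in> X \<Longrightarrow> x = y"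
  shows "(\<Sum>x \<in> X. if \<psi> x then c else 0) = (if \<exists>x \<in> X. \<psi> x then c else 0)"
proof (cases "X = {}")
  case False
  then obtain x where "X = {x}" using assms by blast
  then show ?thesis by simp
qed simp

lemma splittings_words_times_word:
  "(\<Sum>(P, R) \<in> splittings (words (I + sentence_of [w])). g (sentence_of P) (sentence_of R)) =
    (\<Sum>k\<le>length w. \<Sum>(P, R) \<in> splittings (words I).
      g (sentence_of P + sentence_of [take k w]) (sentence_of R + sentence_of [drop k w]))"
  by (cases "w = []") (simp_all add: sum_splittings_snoc)

text \<open>A Leibniz rule: cutting the words of a product cuts \<open>w\<close> separately, at
  \<open>k\<close>. The removed suffix \<open>drop k w\<close> is the last word of the coarsening,
  so it must be spelled by a tail \<open>Q2\<close> of \<open>Q\<close>, while \<open>Q1\<close>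
  acts on \<open>f\<close>.\<close>

lemma skew_coarsening_times_H_word:
  fixes f :: "('a, 'k::comm_ring_1) nsym"
  shows "skew (\<lambda>S. Q \<preceq> S) (f * H_word w) =
    (\<Sum>k\<le>length w. \<Sum>(Q1, Q2) \<in> cuts Q (drop k w). skew (\<lambda>S. Q1 \<preceq> S) f * H_word (take k w))"
proof (induction f rule: nsym_linear_induct)
  case (H I)
  have summand: "(if Q \<preceq> R + sentence_of [drop k w] then H (P + sentence_of [take k w]) else (0 :: ('a, 'k) nsym)) =
      (\<Sum>(Q1, Q2) \<in> cuts Q (drop k w). (if Q1 \<preceq> R then H P else 0) * H_word (take k w))"
    for P R k
  proof -
    \<comment> \<open>There is at most one cut, so the sum over cuts is just the indicator that a
      suitable one exists.\<close>
    have "(\<Sum>(Q1, Q2) \<in> cuts Q (drop k w). (if Q1 \<preceq> R then H P else 0) * H_word (take k w) :: ('a, 'k) nsym) =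
        (\<Sum>x \<in> cuts Q (drop k w). if case x of (Q1, Q2) \<Rightarrow> Q1 \<preceq> R
          then H (P + sentence_of [take k w]) else 0)"
      by (intro sum.cong) (auto simp: H_plus)
    also have "\<dots> = (if \<exists>x \<in> cuts Q (drop k w). case x of (Q1, Q2) \<Rightarrow> Q1 \<preceq> R
          then H (P + sentence_of [take k w]) else 0)"
      by (rule sum_if_subsingleton) (rule cuts_unique)
    finally show ?thesis by (simp only: coarsening_snoc)
  qed
  have "skew (\<lambda>S. Q \<preceq> S) (H I * H_word w :: ('a, 'k) nsym) = (\<Sum>(P, R) \<in> splittings (words (I + sentence_of [w])).
      if Q \<preceq> sentence_of R then H (sentence_of P) else 0)"
    by (simp add: skew_apply_H skew_H_def flip: H_plus)
  also have "\<dots> = (\<Sum>k\<le>length w. \<Sum>(P, R) \<in> splittings (words I).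
      \<Sum>(Q1, Q2) \<in> cuts Q (drop k w).
        (if Q1 \<preceq> sentence_of R then H (sentence_of P) else 0) * H_word (take k w))"
    unfolding splittings_words_times_word[of "\<lambda>P R. if Q \<preceq> R then H P else 0"]
    by (intro sum.cong refl) (auto simp only: prod.case summand)
  also have "\<dots> = (\<Sum>k\<le>length w. \<Sum>(Q1, Q2) \<in> cuts Q (drop k w).
      skew_H (\<lambda>S. Q1 \<preceq> S) I * H_word (take k w))"
    unfolding skew_H_def sum_distrib_right case_prod_unfold
    by (rule sum.cong, simp, rule sum.swap)
  finally show ?case by (simp add: skew_apply_H)
next
  case (scale c f)
  then show ?case
    by (simp add: nsym_scale_mult_left skew_scale nsym.scale_sum_right case_prod_unfold)
next
  case (add f g)
  then show ?case
    by (simp add: distrib_right skew_add sum.distrib case_prod_unfold)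
qed

lemma finite_sentences_concat: "finite {Q :: 'a::finite sentence. concat (words Q) = x}"
  by (rule finite_subset[OF _ finite_letters_le[of "length x"]]) (auto simp: letters_def)

text \<open>The terms with \<open>i < length r\<close> cancel against those with \<open>i = length r\<close>: appending the
  unused rest \<open>drop i r\<close> to \<open>Q\<close> as a last word flips the sign and keeps the argument of \<open>F\<close>.\<close>

lemma alternating_sum_cancel:
  fixes F :: "'a::finite list \<Rightarrow> 'r::ring_1"
  shows "(\<Sum>i\<le>length r. \<Sum>Q \<in> {Q. concat (words Q) = take i r}.
      (- 1) ^ len Q * F (drop i r @ rev_concat Q)) = (if r = [] then F [] else 0)"
proof (cases "r = []")
  case True
  have "{Q :: 'a sentence. concat (words Q) = []} = {0}"
    by (auto simp: concat_words_eq_Nil simp del: concat_eq_Nil_conv)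
  then show ?thesis by (simp add: True del: concat_eq_Nil_conv)
next
  case False
  let ?B = "\<lambda>x. {Q :: 'a sentence. concat (words Q) = x}"
  let ?X = "SIGMA i:{..<length r}. ?B (take i r)"
  let ?h = "\<lambda>(i, Q). Q + sentence_of [drop i r]"
  \<comment> \<open>For \<open>i < length r\<close> the rest \<open>drop i r\<close> is nonempty and
    survives as a genuine last word. Removing the last word inverts the map, and \<open>i\<close> is
    the number of letters left.\<close>
  have inj: "inj_on ?h ?X"
  proof (rule inj_onI)
    fix x y assume xy: "x \<in> ?X" "y \<in> ?X" "?h x = ?h y"
    obtain i Q j S where ij: "x = (i, Q)" "y = (j, S)" by (meson surj_pair)
    with xy have "i < length r" "j < length r"
      and c: "concat (words Q) = take i r" "concat (words S) = take j r" by auto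
    moreover have "words (Q + sentence_of [drop i r]) = words (S + sentence_of [drop j r])"
      using xy(3) ij by simp
    ultimately have "words Q = words S" by simp
    then have "Q = S" by (simp add: words_inject)
    moreover have "i = j"
      using c \<open>Q = S\<close> \<open>i < length r\<close> \<open>j < length r\<close> by (metis length_take min.absorb4)
    ultimately show "x = y" using ij by simp
  qed
  have image: "?h ` ?X = ?B r"
  proof
    show "?h ` ?X \<subseteq> ?B r" by auto
    show "?B r \<subseteq> ?h ` ?X"
    proof
      fix Q assume "Q \<in> ?B r"
      then have Q: "concat (words Q) = r" by simp
      with False obtain X q where Xq: "words Q = X @ [q]"
        by (metis concat.simps(1) rev_exhaust)
      then have ne: "[] \<notin> set X" "q \<noteq> []"
        using words_nonempty[of Q] by auto
      have r: "r = concat X @ q" using Q Xq by simp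
      have "Q = ?h (length (concat X), sentence_of X)"
        using ne by (simp add: Xq r drop_empty_id flip: words_inject)
      moreover have "(length (concat X), sentence_of X) \<in> ?X"
        using ne by (simp add: r)
      ultimately show "Q \<in> ?h ` ?X" by (rule image_eqI)
    qed
  qed
  have "(\<Sum>Q \<in> ?B r. (- 1) ^ len Q * F (rev_concat Q)) =
      (\<Sum>x \<in> ?X. (- 1) ^ len (?h x) * F (rev_concat (?h x)))"
    unfolding image[symmetric] by (simp add: sum.reindex[OF inj])
  also have "\<dots> = (\<Sum>(i, Q) \<in> ?X. - ((- 1) ^ len Q * F (drop i r @ rev_concat Q)))"
    by (rule sum.cong) (auto simp: len_def)
  also have "\<dots> = - (\<Sum>i<length r. \<Sum>Q \<in> ?B (take i r). (- 1) ^ len Q * F (drop i r @ rev_concat Q))"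
    by (simp add: sum.Sigma finite_sentences_concat sum_negf case_prod_unfold)
  finally show ?thesis
    using False by (simp flip: lessThan_Suc_atMost)
qed

text \<open>A sentence together with a cut is a free pair \<open>(Q1, Q2)\<close>. Letter counts
  turn the bound \<open>n\<close> for \<open>Q\<close> into \<open>n - length x\<close> for
  \<open>Q1\<close>, which then shrinks to \<open>d\<close> because the remaining terms
  vanish.\<close>

lemma sum_cuts:
  fixes G :: "'a::finite sentence \<Rightarrow> 'a sentence \<Rightarrow> 'b::comm_monoid_add"
  assumes "d + length x \<le> n" and G: "\<And>Q1 Q2. d < letters Q1 \<Longrightarrow> G Q1 Q2 = 0"
  shows "(\<Sum>Q \<in> {Q. letters Q \<le> n}. \<Sum>(Q1, Q2) \<in> cuts Q x. G Q1 Q2) =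
    (\<Sum>Q1 \<in> {Q. letters Q \<le> d}. \<Sum>Q2 \<in> {Q. concat (words Q) = x}. G Q1 Q2)"
proof -
  let ?B = "{Q :: 'a sentence. concat (words Q) = x}"
  let ?X = "{Q :: 'a sentence. letters Q \<le> n - length x} \<times> ?B"
  have finX: "finite ?X" by (simp add: finite_letters_le finite_sentences_concat)
  have "{z \<in> ?X. fst z + snd z = Q} = cuts Q x" if "letters Q \<le> n" for Q
    using that by (auto simp: cuts_def letters_def)
  then have "(\<Sum>Q \<in> {Q. letters Q \<le> n}. \<Sum>(Q1, Q2) \<in> cuts Q x. G Q1 Q2) =
      (\<Sum>Q \<in> {Q. letters Q \<le> n}. \<Sum>(Q1, Q2) \<in> {z \<in> ?X. fst z + snd z = Q}. G Q1 Q2)"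
    by (intro sum.cong) auto
  also have "\<dots> = (\<Sum>(Q1, Q2) \<in> ?X. G Q1 Q2)"
    using assms(1) by (intro sum.group finX finite_letters_le) (auto simp: letters_def)
  also have "\<dots> = (\<Sum>Q1 \<in> {Q. letters Q \<le> n - length x}. \<Sum>Q2 \<in> ?B. G Q1 Q2)"
    by (simp add: sum.cartesian_product)
  also have "\<dots> = (\<Sum>Q1 \<in> {Q. letters Q \<le> d}. \<Sum>Q2 \<in> ?B. G Q1 Q2)"
    using assms(1) by (intro sum.mono_neutral_right finite_letters_le) (auto intro!: sum.neutral G)
  finally show ?thesis .
qed

lemma sum_triangle_shift:
  fixes g :: "nat \<Rightarrow> nat \<Rightarrow> 'b::comm_monoid_add"
  shows "(\<Sum>j\<le>l. \<Sum>k\<le>j. g j k) = (\<Sum>k\<le>l. \<Sum>i\<le>l - k. g (k + i) k)"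
  unfolding sum.Sigma[OF finite_atMost ballI[OF finite_atMost]]
  by (rule sum.reindex_bij_witness[where i = "\<lambda>(k, i). (k + i, k)" and j = "\<lambda>(j, k). (k, j - k)"]) auto

text \<open>After the Leibniz rule a term on the right has two cut points \<open>k \<le> j\<close>
  in \<open>w\<close>: \<open>take k w\<close> remains as a factor, the middle piece is spelled by
  \<open>Q2\<close>, and \<open>drop j w\<close> goes into the first word. For fixed
  \<open>k\<close> the sum over \<open>j\<close> and \<open>Q2\<close> is alternating and vanishes
  unless \<open>k = length w\<close>; that remaining case is the left side.\<close>

lemma bernstein_times_H_word:
  fixes f :: "('a::finite, 'k::comm_ring_1) nsym"
  assumes v: "v \<noteq> []"
  shows "bernstein v f * H_word w =
    (\<Sum>j\<le>length w. bernstein (v @ drop j w) (f * H_word (take j w)))"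
proof -
  obtain d where d: "\<And>I. I \<in> Poly_Mapping.keys f \<Longrightarrow> letters I \<le> d" by (metis obtain_letters_bound)
  let ?n = "d + length w"
  let ?T = "\<lambda>Q. skew (\<lambda>S. Q \<preceq> S) f"
  have T0: "?T Q = 0" if "d < letters Q" for Q
    by (rule skew_eq_0[OF d]) (use that in \<open>auto dest: coarsening_letters\<close>)
  define G where "G j k Q1 Q2 = (- 1) ^ (len Q1 + len Q2) *
    H_word (v @ drop j w @ rev_concat Q2 @ rev_concat Q1) * ?T Q1 * H_word (take k w)" for j k Q1 Q2
  have bound: "letters I \<le> ?n" if "I \<in> Poly_Mapping.keys (f * H_word (take j w))" for I j
  proof -
    from that keys_mult[of f "H_word (take j w)"] obtain A B where
      "I = A + B" "A \<in> Poly_Mapping.keys f" "B \<in> Poly_Mapping.keys (H_word (take j w) :: ('a, 'k) nsym)"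
      by blast
    then show ?thesis using d[of A] by (simp add: H_def letters_sentence_of add_mono)
  qed
  have step: "bernstein (v @ drop j w) (f * H_word (take j w)) = (\<Sum>k\<le>j.
      \<Sum>Q1 \<in> {Q. letters Q \<le> d}. \<Sum>Q2 \<in> {Q. concat (words Q) = drop k (take j w)}. G j k Q1 Q2)"
    if "j \<le> length w" for j
  proof -
    have "bernstein (v @ drop j w) (f * H_word (take j w)) = (\<Sum>Q \<in> {Q. letters Q \<le> ?n}.
        (- 1) ^ len Q * H_word ((v @ drop j w) @ rev_concat Q) *
        skew (\<lambda>S. Q \<preceq> S) (f * H_word (take j w)))"
      using v by (intro bernstein_eq bound) simp
    also have "\<dots> = (\<Sum>Q \<in> {Q. letters Q \<le> ?n}. \<Sum>k\<le>j. \<Sum>(Q1, Q2) \<in> cuts Q (drop k (take j w)). G j k Q1 Q2)"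
      using that
      by (intro sum.cong refl)
        (auto simp: skew_coarsening_times_H_word sum_distrib_left G_def cuts_def mult.assoc intro!: sum.cong)
    also have "\<dots> = (\<Sum>k\<le>j. \<Sum>Q \<in> {Q. letters Q \<le> ?n}. \<Sum>(Q1, Q2) \<in> cuts Q (drop k (take j w)). G j k Q1 Q2)"
      by (rule sum.swap)
    also have "\<dots> = (\<Sum>k\<le>j. \<Sum>Q1 \<in> {Q. letters Q \<le> d}.
        \<Sum>Q2 \<in> {Q. concat (words Q) = drop k (take j w)}. G j k Q1 Q2)"
      using that by (intro sum.cong refl sum_cuts) (auto simp: G_def T0)
    finally show ?thesis .
  qed
  have cancel: "(\<Sum>i\<le>length w - k. \<Sum>Q1 \<in> {Q. letters Q \<le> d}.
        \<Sum>Q2 \<in> {Q. concat (words Q) = drop k (take (k + i) w)}. G (k + i) k Q1 Q2) =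
      (if k = length w then bernstein v f * H_word w else 0)" if "k \<le> length w" for k
  proof -
    define r where "r = drop k w"
    define F where "F Q1 x = H_word (v @ x @ rev_concat Q1) * ?T Q1 * H_word (take k w)" for Q1 x
    \<comment> \<open>With \<open>r\<close> the part of \<open>w\<close> after \<open>k\<close>, the
      position \<open>j = k + i\<close> cuts \<open>r\<close> at \<open>i\<close>. The sign factors
      because \<open>len\<close> is additive.\<close>
    have sgn: "G (k + i) k Q1 Q2 = (- 1) ^ len Q1 * ((- 1) ^ len Q2 * F Q1 (drop i r @ rev_concat Q2))"
      for i Q1 Q2
      by (simp add: G_def F_def r_def power_add mult.assoc add.commute)
    have "(\<Sum>i\<le>length w - k. \<Sum>Q1 \<in> {Q. letters Q \<le> d}.
        \<Sum>Q2 \<in> {Q. concat (words Q) = drop k (take (k + i) w)}. G (k + i) k Q1 Q2) =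
      (\<Sum>Q1 \<in> {Q. letters Q \<le> d}. (- 1) ^ len Q1 * (\<Sum>i\<le>length r.
        \<Sum>Q2 \<in> {Q. concat (words Q) = take i r}. (- 1) ^ len Q2 * F Q1 (drop i r @ rev_concat Q2)))"
      unfolding sgn by (subst sum.swap) (simp add: sum_distrib_left r_def take_drop add.commute)
    also have "\<dots> = (\<Sum>Q1 \<in> {Q. letters Q \<le> d}. (- 1) ^ len Q1 * (if r = [] then F Q1 [] else 0))"
      unfolding alternating_sum_cancel ..
    also have "\<dots> = (if k = length w then bernstein v f * H_word w else 0)"
      using that by (auto simp: r_def F_def bernstein_eq[OF v d] sum_distrib_right mult.assoc)
    finally show ?thesis .
  qed
  have "(\<Sum>j\<le>length w. bernstein (v @ drop j w) (f * H_word (take j w))) =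
      (\<Sum>j\<le>length w. \<Sum>k\<le>j. \<Sum>Q1 \<in> {Q. letters Q \<le> d}.
        \<Sum>Q2 \<in> {Q. concat (words Q) = drop k (take j w)}. G j k Q1 Q2)"
    by (intro sum.cong refl step) simp_all
  also have "\<dots> = (\<Sum>k\<le>length w. if k = length w then bernstein v f * H_word w else 0)"
    unfolding sum_triangle_shift by (intro sum.cong refl cancel) simp_all
  finally show ?thesis by simp
qed

subsection \<open>Tableaux\<close>

text \<open>A colored tableau is encoded as the list of its rows, each box being the pair of its color
  and its entry.\<close>

type_synonym 'a colored_rows = "('a \<times> nat) list list"

definition immaculate_rows :: "'a colored_rows \<Rightarrow> ('a, 'k::comm_ring_1) nsym"
  where "immaculate_rows D = foldr bernstein (map (map fst) D) 1"

definition is_tableau :: "'a colored_rows \<Rightarrow> bool"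
  where "is_tableau D \<longleftrightarrow>
    (\<forall>r \<in> set D. r \<noteq> [] \<and> sorted (map snd r) \<and> (\<forall>x \<in> set r. 1 \<le> snd x)) \<and>
    sorted_wrt (<) (map (\<lambda>r. snd (hd r)) D)"

definition colors_of :: "'a colored_rows \<Rightarrow> nat \<Rightarrow> 'a list"
  where "colors_of D i = concat (map (\<lambda>r. map fst (filter (\<lambda>x. snd x = i) r)) (rev D))"

text \<open>The type is prescribed entry by entry, with the shift \<open>i - 1\<close> because
  entries start at 1. The default \<open>[]\<close> excludes entries beyond
  \<open>length X\<close>.\<close>

definition tableaux_of_type :: "'a list list \<Rightarrow> 'a colored_rows set"
  where "tableaux_of_type X = {D. is_tableau D \<and>
    (\<forall>i \<ge> 1. colors_of D i = (if i \<le> length X then X ! (i - 1) else []))}"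

text \<open>The top row takes the suffix \<open>drop j w\<close> because colors are read from the
  lowest row upwards. Below the last row, \<open>drop_empty\<close> makes an empty remainder add no
  row.\<close>

fun extensions :: "nat \<Rightarrow> 'a colored_rows \<Rightarrow> 'a list \<Rightarrow> 'a colored_rows set"
  where
    "extensions m [] w = {drop_empty [map (\<lambda>c. (c, m)) w]}"
  | "extensions m (r # D) w =
      (\<Union>j \<in> {..length w}. (#) (r @ map (\<lambda>c. (c, m)) (drop j w)) ` extensions m D (take j w))"

lemma finite_extensions [simp]: "finite (extensions m D w)"
  by (induction m D w rule: extensions.induct) auto

lemma immaculate_rows_Cons:
  "immaculate_rows (r # D) = bernstein (map fst r) (immaculate_rows D)"
  by (simp add: immaculate_rows_def)

text \<open>Each row of \<open>D\<close> uses the Pieri rule once and passes \<open>take j w\<close>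
  on to the rows below it; linearity of \<open>bernstein\<close> then admits the induction
  hypothesis.\<close>

lemma sum_extensions:
  assumes "[] \<notin> set D"
  shows "(\<Sum>E \<in> extensions m D w. immaculate_rows E) =
    (immaculate_rows D * H_word w :: ('a::finite, 'k::comm_ring_1) nsym)"
  using assms
proof (induction m D w rule: extensions.induct)
  case (1 m w)
  have "map fst (map (\<lambda>c. (c, m)) w) = w" by (simp add: o_def)
  then show ?case
    by (cases "w = []") (simp_all add: immaculate_rows_def bernstein_one)
next
  case (2 m r D w)
  let ?r = "\<lambda>j. r @ map (\<lambda>c. (c, m)) (drop j w)"
  have r: "map fst r \<noteq> []" and D: "[] \<notin> set D" using 2(2) by auto
  have fst: "map fst (?r j) = map fst r @ drop j w" for j by (simp add: o_def)
  have "(\<Sum>E \<in> extensions m (r # D) w. immaculate_rows E :: ('a, 'k) nsym) =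
      (\<Sum>j\<le>length w. \<Sum>E \<in> (#) (?r j) ` extensions m D (take j w). immaculate_rows E)"
    unfolding extensions.simps
  proof (rule sum.UNION_disjoint)
    show "\<forall>i \<in> {..length w}. \<forall>j \<in> {..length w}. i \<noteq> j \<longrightarrow>
        (#) (?r i) ` extensions m D (take i w) \<inter> (#) (?r j) ` extensions m D (take j w) = {}"
    proof (intro ballI impI)
      fix i j assume "i \<in> {..length w}" "j \<in> {..length w}" "i \<noteq> j"
      \<comment> \<open>The length of the new top row reveals the cut point, so different cuts give
        disjoint sets.\<close>
      then have "length (?r i) \<noteq> length (?r j)" by auto
      then have "?r i \<noteq> ?r j" by metis
      then show "(#) (?r i) ` extensions m D (take i w) \<inter> (#) (?r j) ` extensions m D (take j w) = {}"
        by blast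
    qed
  qed simp_all
  also have "\<dots> = (\<Sum>j\<le>length w. \<Sum>E \<in> extensions m D (take j w).
      bernstein (map fst r @ drop j w) (immaculate_rows E))"
    by (simp add: sum.reindex immaculate_rows_Cons o_def)
  also have "\<dots> = (\<Sum>j\<le>length w. bernstein (map fst r @ drop j w)
      (immaculate_rows D * H_word (take j w)))"
    using 2(1)[OF _ D] r by (intro sum.cong) (simp_all flip: bernstein_sum)
  also have "\<dots> = immaculate_rows (r # D) * H_word w"
    by (simp add: immaculate_rows_Cons bernstein_times_H_word[OF r])
  finally show ?case .
qed

section \<open>Adding and removing the largest entry\<close>

definition entries_below :: "nat \<Rightarrow> 'a colored_rows \<Rightarrow> 'a colored_rows"
  where "entries_below m D = drop_empty (map (filter (\<lambda>x. snd x < m)) D)"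

lemma colors_of_Nil [simp]: "colors_of [] i = []"
  by (simp add: colors_of_def)

lemma colors_of_Cons [simp]:
  "colors_of (r # D) i = colors_of D i @ map fst (filter (\<lambda>x. snd x = i) r)"
  by (simp add: colors_of_def)

lemma colors_of_eq_Nil_iff: "colors_of D i = [] \<longleftrightarrow> i \<notin> snd ` set (concat D)"
  by (induction D) (auto simp: filter_empty_conv)

lemma colors_of_drop_empty [simp]: "colors_of (drop_empty D) i = colors_of D i"
  by (induction D) auto

lemma is_tableau_Cons:
  "is_tableau (r # D) \<longleftrightarrow> r \<noteq> [] \<and> sorted (map snd r) \<and> (\<forall>x \<in> set r. 1 \<le> snd x) \<and>
    (\<forall>s \<in> set D. snd (hd r) < snd (hd s)) \<and> is_tableau D"
  by (auto simp: is_tableau_def)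

lemma length_extension:
  "E \<in> extensions m D w \<Longrightarrow> length (concat E) = length (concat D) + length w"
  by (induction m D w arbitrary: E rule: extensions.induct) fastforce+

lemma colors_of_extension:
  assumes "E \<in> extensions m D w" "m \<notin> snd ` set (concat D)"
  shows "colors_of E i = (if i = m then w else colors_of D i)"
  using assms
proof (induction m D w arbitrary: E rule: extensions.induct)
  case (1 m w)
  then show ?case by (simp add: o_def)
next
  case (2 m r D w)
  then obtain j E' where j: "j \<le> length w" "E' \<in> extensions m D (take j w)"
    and E: "E = (r @ map (\<lambda>c. (c, m)) (drop j w)) # E'"
    by auto
  have "colors_of E' i = (if i = m then take j w else colors_of D i)"
    by (rule 2(1)) (use j 2(3) in auto)
  moreover have "filter (\<lambda>x. snd x = m) r = []"
    using 2(3) by (auto simp: filter_empty_conv)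
  ultimately show ?case by (auto simp: E o_def)
qed

text \<open>An extension determines the tableau it came from; this makes the extension sets of
  different tableaux disjoint.\<close>

lemma entries_below_extension:
  assumes "E \<in> extensions m D w" "[] \<notin> set D" "\<forall>x \<in> set (concat D). snd x < m"
  shows "entries_below m E = D"
  using assms
proof (induction m D w arbitrary: E rule: extensions.induct)
  case (1 m w)
  then show ?case by (auto simp: entries_below_def)
next
  case (2 m r D w)
  then obtain j E' where j: "j \<le> length w" "E' \<in> extensions m D (take j w)"
    and E: "E = (r @ map (\<lambda>c. (c, m)) (drop j w)) # E'"
    by auto
  have "entries_below m E' = D" using 2 j by auto
  moreover have "filter (\<lambda>x. snd x < m) r = r" using 2(4) by (auto simp: filter_id_conv)
  ultimately show ?case using 2(3) by (auto simp: E entries_below_def)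
qed

lemma head_extension:
  assumes "E \<in> extensions m D w" "[] \<notin> set D" "e \<in> set E"
  shows "snd (hd e) \<in> insert m ((\<lambda>r. snd (hd r)) ` set D)"
  using assms
proof (induction m D w arbitrary: E rule: extensions.induct)
  case (1 m w)
  then show ?case by (auto simp: hd_map split: if_splits)
next
  case (2 m r D w)
  then obtain j E' where j: "j \<le> length w" "E' \<in> extensions m D (take j w)"
    and E: "E = (r @ map (\<lambda>c. (c, m)) (drop j w)) # E'"
    by auto
  show ?case
  proof (cases "e \<in> set E'")
    case True
    then show ?thesis using 2(1)[of j E'] 2(3) j by auto
  next
    case False
    then have "e = r @ map (\<lambda>c. (c, m)) (drop j w)" using 2(4) E by simp
    then show ?thesis using 2(3) by auto
  qed
qed

lemma is_tableau_extension:
  assumes "E \<in> extensions m D w" "is_tableau D" "\<forall>x \<in> set (concat D). snd x < m" "1 \<le> m"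
  shows "is_tableau E"
  using assms
proof (induction m D w arbitrary: E rule: extensions.induct)
  case (1 m w)
  have "sorted (map (\<lambda>c. m) w)" by (induction w) auto
  with 1 show ?case by (auto simp: is_tableau_def o_def)
next
  case (2 m r D w)
  then obtain j E' where j: "j \<le> length w" "E' \<in> extensions m D (take j w)"
    and E: "E = (r @ map (\<lambda>c. (c, m)) (drop j w)) # E'"
    by auto
  have r: "r \<noteq> []" "sorted (map snd r)" "\<forall>x \<in> set r. 1 \<le> snd x" "is_tableau D"
      "\<forall>s \<in> set D. snd (hd r) < snd (hd s)"
    using 2(3) by (auto simp: is_tableau_Cons)
  have "is_tableau E'" using 2 j r by auto
  moreover have "sorted (map (\<lambda>c. m) (drop j w))" by (induction "drop j w") (auto simp: sorted_wrt_map)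
  then have "sorted (map snd (r @ map (\<lambda>c. (c, m)) (drop j w)))"
    using r(2) 2(4) by (auto simp: sorted_append o_def less_imp_le)
  \<comment> \<open>A row below starts either with an old first entry, larger by assumption on
    \<open>r # D\<close>, or with \<open>m\<close>, which exceeds all old entries.\<close>
  moreover have "snd (hd r) < snd (hd s)" if "s \<in> set E'" for s
  proof -
    have "[] \<notin> set D" using r(4) by (auto simp: is_tableau_def)
    with head_extension[OF j(2) _ that] have "snd (hd s) = m \<or> (\<exists>t \<in> set D. snd (hd s) = snd (hd t))"
      by auto
    moreover have "snd (hd r) < m" using r(1) 2(4) by simp
    ultimately show ?thesis using r(5) by auto
  qed
  ultimately show ?case using r(1,3) 2(5) by (auto simp: E is_tableau_Cons)
qed

lemma sorted_eq_filters:
  assumes "sorted (map snd r)" "\<forall>x \<in> set r. snd x \<le> (m :: nat)"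
  shows "r = filter (\<lambda>x. snd x < m) r @ map (\<lambda>c. (c, m)) (map fst (filter (\<lambda>x. snd x = m) r))"
  using assms
proof (induction r)
  case (Cons x r)
  show ?case
  proof (cases "snd x = m")
    case True
    then have all: "\<forall>y \<in> set r. snd y = m" using Cons.prems by (auto intro: antisym)
    then have "filter (\<lambda>y. snd y < m) r = []" "filter (\<lambda>y. snd y = m) r = r"
      by (auto simp: filter_empty_conv filter_id_conv)
    moreover have "map (\<lambda>c. (c, m)) (map fst r) = r"
      unfolding map_map by (rule map_idI) (use all in \<open>auto simp: prod_eq_iff\<close>)
    ultimately show ?thesis using True by (cases x) simp
  next
    case False
    with Cons show ?thesis by (auto simp: le_less)
  qed
qed simp

lemma extension_of_entries_below:
  assumes "is_tableau E" "\<forall>x \<in> set (concat E). snd x \<le> m"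
  shows "E \<in> extensions m (entries_below m E) (colors_of E m)"
  using assms
proof (induction E)
  case (Cons r E)
  let ?low = "filter (\<lambda>x. snd x < m) r" and ?high = "map fst (filter (\<lambda>x. snd x = m) r)"
  have r: "r \<noteq> []" "sorted (map snd r)" "is_tableau E" "\<forall>s \<in> set E. snd (hd r) < snd (hd s)"
    using Cons.prems by (auto simp: is_tableau_Cons)
  have r_eq: "r = ?low @ map (\<lambda>c. (c, m)) ?high"
    by (rule sorted_eq_filters) (use r Cons.prems in auto)
  have IH: "E \<in> extensions m (entries_below m E) (colors_of E m)" using Cons r by simp
  show ?case
  proof (cases "?low = []")
    case True
    then have "r = map (\<lambda>c. (c, m)) ?high" using r_eq by simp
    then have "snd (hd r) = m" using r(1) by (metis hd_map list.map_disc_iff snd_conv)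
    moreover have "snd (hd s) \<le> m" if "s \<in> set E" for s
    proof -
      have "s \<noteq> []" using r(3) that by (auto simp: is_tableau_def)
      then have "hd s \<in> set s" by simp
      then have "hd s \<in> set (concat (r # E))" using that by auto
      then show ?thesis using Cons.prems(2) by blast
    qed
    \<comment> \<open>A row consisting of \<open>m\<close> alone must be the last one: a lower row
      would have to start with an entry larger than the maximum \<open>m\<close>.\<close>
    ultimately have "E = []" using r(4) by (cases E) force+
    then show ?thesis
      using True r(1) \<open>r = map (\<lambda>c. (c, m)) ?high\<close> by (simp add: entries_below_def)
  next
    case False
    \<comment> \<open>The cut point is the number of boxes containing \<open>m\<close> in the lower
      rows, since their colors are read first.\<close>
    have "r # E = (?low @ map (\<lambda>c. (c, m)) (drop (length (colors_of E m)) (colors_of (r # E) m))) # E"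
      using r_eq by simp
    moreover have "E \<in> extensions m (entries_below m E) (take (length (colors_of E m)) (colors_of (r # E) m))"
      using IH by simp
    moreover have "length (colors_of E m) \<le> length (colors_of (r # E) m)" by simp
    ultimately have "r # E \<in> extensions m (?low # entries_below m E) (colors_of (r # E) m)"
      unfolding extensions.simps by blast
    moreover have "entries_below m (r # E) = ?low # entries_below m E" using False by (simp add: entries_below_def)
    ultimately show ?thesis by simp
  qed
qed (simp add: entries_below_def)

lemma colors_of_entries_below: "colors_of (entries_below m E) i = (if i < m then colors_of E i else [])"
proof -
  have "filter (\<lambda>x. snd x = i) (filter (\<lambda>x. snd x < m) r) =
      (if i < m then filter (\<lambda>x. snd x = i) r else [])" for r :: "('a \<times> nat) list"
    by (induction r) auto
  then have "colors_of (map (filter (\<lambda>x. snd x < m)) E) i = (if i < m then colors_of E i else [])"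
    by (induction E) (auto simp del: filter_filter)
  then show ?thesis by (simp add: entries_below_def)
qed

lemma hd_filter_less:
  assumes "sorted (map snd r)" "filter (\<lambda>x. snd x < (m :: nat)) r \<noteq> []"
  shows "hd (filter (\<lambda>x. snd x < m) r) = hd r"
proof (cases r)
  case (Cons x s)
  obtain y where "y \<in> set r" "snd y < m" using assms(2) by (auto simp: filter_empty_conv)
  then have "snd x < m" using assms(1) Cons by auto
  then show ?thesis using Cons by simp
qed (use assms in simp)

text \<open>A sorted row with some entry below \<open>m\<close> starts with such an entry. Surviving
  rows thus keep their first entries, and the new first column is a subsequence of the old
  one.\<close>

lemma is_tableau_entries_below:
  assumes "is_tableau E"
  shows "is_tableau (entries_below m E)"
proof -
  let ?f = "filter (\<lambda>x. snd x < m)"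
  let ?F = "filter (\<lambda>r. ?f r \<noteq> []) E"
  have entries_below: "entries_below m E = map ?f ?F"
    by (simp add: entries_below_def filter_map o_def)
  have "map (\<lambda>r. snd (hd r)) (entries_below m E) = map (\<lambda>r. snd (hd r)) ?F"
    unfolding entries_below using assms by (auto simp: is_tableau_def hd_filter_less)
  moreover have "sorted_wrt (<) (map (\<lambda>r. snd (hd r)) ?F)"
    using assms by (simp add: is_tableau_def sorted_wrt_map sorted_wrt_filter)
  moreover have "\<forall>r \<in> set (entries_below m E). r \<noteq> [] \<and> sorted (map snd r) \<and> (\<forall>x \<in> set r. 1 \<le> snd x)"
    using assms unfolding entries_below is_tableau_def by (fastforce intro: sorted_filter)
  ultimately show ?thesis by (simp add: is_tableau_def)
qed

section \<open>Tableaux of a prescribed type\<close>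

lemma tableaux_of_type_entries:
  assumes "D \<in> tableaux_of_type X" "x \<in> set (concat D)"
  shows "1 \<le> snd x" "snd x \<le> length X"
proof -
  show "1 \<le> snd x" using assms by (auto simp: tableaux_of_type_def is_tableau_def)
  moreover have "colors_of D (snd x) \<noteq> []" using assms(2) by (auto simp: colors_of_eq_Nil_iff)
  ultimately show "snd x \<le> length X"
    using assms(1) unfolding tableaux_of_type_def by (metis (mono_tags, lifting) mem_Collect_eq)
qed

lemma tableaux_of_type_nonempty_rows: "D \<in> tableaux_of_type X \<Longrightarrow> [] \<notin> set D"
  by (auto simp: tableaux_of_type_def is_tableau_def)

lemma tableaux_of_type_snoc:
  "tableaux_of_type (X @ [w]) = (\<Union>D \<in> tableaux_of_type X. extensions (Suc (length X)) D w)"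
  (is "?L = ?R")
proof
  let ?m = "Suc (length X)"
  show "?L \<subseteq> ?R"
  proof
    fix E assume E: "E \<in> ?L"
    have "colors_of E ?m = w" using E by (simp add: tableaux_of_type_def)
    moreover have "E \<in> extensions ?m (entries_below ?m E) (colors_of E ?m)"
      by (rule extension_of_entries_below)
        (use E tableaux_of_type_entries(2)[OF E] in \<open>auto simp: tableaux_of_type_def\<close>)
    moreover have "entries_below ?m E \<in> tableaux_of_type X"
      using E by (auto simp: tableaux_of_type_def is_tableau_entries_below colors_of_entries_below nth_append)
    ultimately show "E \<in> ?R" by blast
  qed
  show "?R \<subseteq> ?L"
  proof
    fix E assume "E \<in> ?R"
    then obtain D where D: "D \<in> tableaux_of_type X" and E: "E \<in> extensions ?m D w" by blast
    have less: "\<forall>x \<in> set (concat D). snd x < ?m"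
      using tableaux_of_type_entries(2)[OF D] by (simp add: less_Suc_eq_le)
    then have "?m \<notin> snd ` set (concat D)" by force
    with E have "colors_of E i = (if i = ?m then w else colors_of D i)" for i
      by (rule colors_of_extension)
    moreover have "is_tableau E"
      by (rule is_tableau_extension[OF E _ less]) (use D in \<open>auto simp: tableaux_of_type_def\<close>)
    ultimately show "E \<in> ?L"
      using D by (auto simp: tableaux_of_type_def nth_append)
  qed
qed

lemma tableaux_of_type_Nil: "tableaux_of_type [] = {[]}"
proof -
  have "D = []" if D: "D \<in> tableaux_of_type []" for D :: "'a colored_rows"
  proof (rule ccontr)
    assume "D \<noteq> []"
    then obtain r where "r \<in> set D" "r \<noteq> []"
      using tableaux_of_type_nonempty_rows[OF D] hd_in_set by metis
    then have "hd r \<in> set r" by simp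
    with \<open>r \<in> set D\<close> have "hd r \<in> set (concat D)" by auto
    then show False using tableaux_of_type_entries[OF D, of "hd r"] by simp
  qed
  then show ?thesis by (auto simp: tableaux_of_type_def is_tableau_def)
qed

lemma finite_tableaux_of_type: "finite (tableaux_of_type X)"
  by (induction X rule: rev_induct) (auto simp: tableaux_of_type_Nil tableaux_of_type_snoc)

lemma length_concat_tableau:
  "D \<in> tableaux_of_type X \<Longrightarrow> length (concat D) = length (concat X)"
  by (induction X arbitrary: D rule: rev_induct)
    (auto simp: tableaux_of_type_Nil tableaux_of_type_snoc dest!: length_extension)

lemma sum_tableaux_of_type:
  "(\<Sum>D \<in> tableaux_of_type X. immaculate_rows D) =
    (H (sentence_of X) :: ('a::finite, 'k::comm_ring_1) nsym)"
proof (induction X rule: rev_induct)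
  case Nil
  then show ?case by (simp add: tableaux_of_type_Nil immaculate_rows_def)
next
  case (snoc w X)
  let ?m = "Suc (length X)"
  have "entries_below ?m E = D" if "D \<in> tableaux_of_type X" "E \<in> extensions ?m D w" for D E
    using that tableaux_of_type_entries(2)[OF that(1)]
    by (intro entries_below_extension) (auto simp: tableaux_of_type_nonempty_rows less_Suc_eq_le)
  then have "(\<Sum>D \<in> tableaux_of_type (X @ [w]). immaculate_rows D :: ('a, 'k) nsym) =
      (\<Sum>D \<in> tableaux_of_type X. \<Sum>E \<in> extensions ?m D w. immaculate_rows E)"
    unfolding tableaux_of_type_snoc
    by (intro sum.UNION_disjoint finite_tableaux_of_type) (simp, blast)
  also have "\<dots> = (\<Sum>D \<in> tableaux_of_type X. immaculate_rows D * H_word w)"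
    by (intro sum.cong sum_extensions) (simp_all add: tableaux_of_type_nonempty_rows)
  also have "\<dots> = H (sentence_of (X @ [w]))"
    by (simp add: snoc H_plus flip: sum_distrib_right)
  finally show ?case .
qed

section \<open>Comparison with the tableaux counted by \<open>K\<close>\<close>

lemma filter_zip_eq:
  "[c. (c, n) \<leftarrow> zip w r, n = i] = map fst (filter (\<lambda>x. snd x = i) (zip w r))"
  by (induction w r rule: list_induct2') (auto split: prod.splits)

lemma colors_of_zip: "colors_of (map2 zip (words J) T) i = color_word J T i"
  unfolding colors_of_def color_word_def filter_zip_eq
  by (simp add: rev_map case_prod_unfold o_def)

text \<open>The list on the left stops at the largest entry, whereas the right side speaks of all
  \<open>i\<close>. They agree because a color word is empty exactly when its entry does not occur,
  and no word of \<open>C\<close> is empty; so the largest entry is the number of words of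
  \<open>C\<close>.\<close>

lemma tableau_type_iff:
  assumes len: "map length T = map length (words J)"
  shows "tableau_type J T = words C \<longleftrightarrow>
    (\<forall>i \<ge> 1. color_word J T i = (if i \<le> length (words C) then words C ! (i - 1) else []))"
    (is "_ \<longleftrightarrow> ?rhs")
proof -
  let ?N = "Max (insert 0 (set (concat T)))"
  have "map (map snd) (map2 zip X T) = T" if "map length T = map length X" for X :: "'a list list"
    using that by (induction X T rule: list_induct2') auto
  then have "snd ` set (concat (map2 zip (words J) T)) = set (concat T)"
    using len by (metis map_concat set_map)
  then have Nil: "color_word J T i = [] \<longleftrightarrow> i \<notin> set (concat T)" for i
    by (simp only: colors_of_eq_Nil_iff flip: colors_of_zip)
  have le: "i \<le> ?N" if "i \<in> set (concat T)" for i
    using that by (intro Max_ge) auto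
  have len_type: "length (tableau_type J T) = ?N"
    by (simp add: tableau_type_def del: upt_Suc)
  have nth_type: "tableau_type J T ! k = color_word J T (Suc k)" if "k < ?N" for k
    using that unfolding tableau_type_def by (subst nth_map) (simp_all del: upt_Suc)
  show ?thesis
  proof
    assume eq: "tableau_type J T = words C"
    show ?rhs
    proof (intro allI impI)
      fix i :: nat assume "1 \<le> i"
      then show "color_word J T i = (if i \<le> length (words C) then words C ! (i - 1) else [])"
      proof (cases "i \<le> ?N")
        case True
        then show ?thesis
          using nth_type[of "i - 1"] \<open>1 \<le> i\<close> len_type unfolding eq by simp
      next
        case False
        then have "color_word J T i = []" using le Nil by blast
        with False show ?thesis using len_type unfolding eq by simp
      qed
    qed
  next
    assume rhs: ?rhs
    have "?N \<le> length (words C)"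
    proof (cases "?N = 0")
      case False
      have "?N \<in> insert 0 (set (concat T))" by (rule Max_in) auto
      with False have "color_word J T ?N \<noteq> []" unfolding Nil by simp
      with rhs False show ?thesis by (metis One_nat_def Suc_leI gr0I)
    qed simp
    moreover have "length (words C) \<le> ?N"
    proof (cases "words C = []")
      case False
      then have "words C ! (length (words C) - 1) \<noteq> []"
        using words_nonempty[of C] by (metis diff_less length_greater_0_conv less_one nth_mem)
      moreover have "1 \<le> length (words C)" using False by (cases "words C") auto
      ultimately have "color_word J T (length (words C)) \<noteq> []" using rhs by simp
      then show ?thesis by (intro le) (simp only: Nil not_not)
    qed simp
    ultimately have N: "?N = length (words C)" by (rule antisym)
    show "tableau_type J T = words C"
    proof (rule nth_equalityI)
      show "length (tableau_type J T) = length (words C)" using len_type N by simp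
      fix k assume "k < length (tableau_type J T)"
      then have "k < ?N" by (simp only: len_type)
      then show "tableau_type J T ! k = words C ! k"
        using nth_type[of k] rhs N by simp
    qed
  qed
qed

lemma is_tableau_zip:
  assumes "map length T = map length (words J)"
  shows "is_tableau (map2 zip (words J) T) \<longleftrightarrow> immaculate_tableau J T"
proof -
  have "is_tableau (map2 zip X T) \<longleftrightarrow>
      (\<forall>r \<in> set T. sorted r \<and> (\<forall>n \<in> set r. 1 \<le> n)) \<and> sorted_wrt (<) (map hd T)"
    if "map length T = map length X" "[] \<notin> set X" for X :: "'a list list"
    using that
  proof (induction X T rule: list_induct2')
    case (4 w X r T)
    then have len: "length r = length w" "map length T = map length X" "w \<noteq> []" "r \<noteq> []"
      by auto
    have "snd ` set (zip w r) = set r"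
      using len by (metis map_snd_zip set_map)
    then have entries: "(\<forall>x \<in> set (zip w r). 1 \<le> snd x) \<longleftrightarrow> (\<forall>n \<in> set r. 1 \<le> n)"
      by (metis (no_types, lifting) image_iff)
    have heads: "(\<lambda>r. snd (hd r)) ` set (map2 zip X T) = hd ` set T"
    proof -
      have "snd (hd (zip x y)) = hd y" if "length y = length x" "[] \<noteq> x" for x :: "'a list" and y :: "nat list"
        using that by (cases x; cases y) auto
      then have "map (\<lambda>r. snd (hd r)) (map2 zip X T) = map hd T"
        using len(2) 4(3) by (induction X T rule: list_induct2') auto
      then show ?thesis by (metis set_map)
    qed
    have "(\<forall>s \<in> set (map2 zip X T). snd (hd (zip w r)) < snd (hd s)) \<longleftrightarrow>
        (\<forall>n \<in> (\<lambda>r. snd (hd r)) ` set (map2 zip X T). snd (hd (zip w r)) < n)"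
      by simp
    also have "\<dots> \<longleftrightarrow> (\<forall>s \<in> set T. hd r < hd s)"
      unfolding heads using len by (simp add: hd_zip)
    finally show ?case
      using 4 len entries by (auto simp: is_tableau_Cons)
  qed (auto simp: is_tableau_def)
  from this[OF assms words_nonempty] show ?thesis
    using assms by (simp add: immaculate_tableau_def)
qed

text \<open>Zipping the colors of \<open>J\<close> with a filling is a bijection onto the colored
  tableaux whose color rows are \<open>J\<close>; its inverse forgets the colors.\<close>

lemma K_eq_card:
  "K J C = card {D \<in> tableaux_of_type (words C). sentence_of (map (map fst) D) = J}"
proof -
  let ?A = "{T. immaculate_tableau J T \<and> tableau_type J T = words C}"
  let ?B = "{D \<in> tableaux_of_type (words C). sentence_of (map (map fst) D) = J}"
  have zip: "map (map fst) (map2 zip X T) = X" "map (map snd) (map2 zip X T) = T"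
    if "map length T = map length X" for X :: "'a list list" and T :: "nat list list"
    using that by (induction X T rule: list_induct2') auto
  have unzip: "map2 zip (map (map fst) D) (map (map snd) D) = D" for D :: "'a colored_rows"
    by (induction D) (auto simp: zip_map_fst_snd)
  have words_B: "words J = map (map fst) D" if "D \<in> ?B" for D
  proof -
    have "[] \<notin> set (map (map fst) D)"
      using that tableaux_of_type_nonempty_rows by auto
    with that show ?thesis by (auto simp: drop_empty_id)
  qed
  have A: "T \<in> ?A \<longleftrightarrow> map2 zip (words J) T \<in> tableaux_of_type (words C)"
    if "map length T = map length (words J)" for T
    using that by (simp add: tableaux_of_type_def is_tableau_zip tableau_type_iff colors_of_zip)
  have "bij_betw (map2 zip (words J)) ?A ?B"
  proof (rule bij_betw_byWitness[where f' = "map (map snd)"])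
    have len: "map length T = map length (words J)" if "T \<in> ?A" for T
      using that by (simp add: immaculate_tableau_def)
    show "\<forall>T \<in> ?A. map (map snd) (map2 zip (words J) T) = T"
      using zip(2) len by blast
    show "\<forall>D \<in> ?B. map2 zip (words J) (map (map snd) D) = D"
    proof
      fix D assume "D \<in> ?B"
      show "map2 zip (words J) (map (map snd) D) = D"
        by (simp only: words_B[OF \<open>D \<in> ?B\<close>] unzip)
    qed
    show "map2 zip (words J) ` ?A \<subseteq> ?B"
    proof
      fix D assume "D \<in> map2 zip (words J) ` ?A"
      then obtain T where T: "T \<in> ?A" "D = map2 zip (words J) T" by blast
      then show "D \<in> ?B"
        using A[OF len[OF T(1)]] zip(1)[OF len[OF T(1)]] by simp
    qed
    show "map (map snd) ` ?B \<subseteq> ?A"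
    proof
      fix T assume "T \<in> map (map snd) ` ?B"
      then obtain D where D: "D \<in> ?B" "T = map (map snd) D" by blast
      have "map length T = map length (words J)" by (simp add: D(2) words_B[OF D(1)] o_def)
      moreover have "map2 zip (words J) T = D" by (simp only: D(2) words_B[OF D(1)] unzip)
      ultimately show "T \<in> ?A" using A[of T] D(1) by simp
    qed
  qed
  then show ?thesis unfolding K_def by (rule bij_betw_same_card)
qed

theorem theorem5p12:
  fixes C :: "'a::finite sentence"
  shows "(H C :: ('a, 'k::comm_ring_1) nsym) =
    (\<Sum>J \<in> {J. letters J = letters C}. of_nat (K J C) * immaculate J)"
proof -
  let ?S = "tableaux_of_type (words C)"
  let ?shape = "\<lambda>D :: 'a colored_rows. sentence_of (map (map fst) D)"
  have imm: "immaculate_rows D = (immaculate (?shape D) :: ('a, 'k) nsym)" if "D \<in> ?S" for D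
  proof -
    have "[] \<notin> set (map (map fst) D)"
      using tableaux_of_type_nonempty_rows[OF that] by auto
    then show ?thesis by (simp add: immaculate_def immaculate_rows_def drop_empty_id)
  qed
  have letters: "letters (?shape D) = letters C" if "D \<in> ?S" for D
  proof -
    have "length (concat (map (map fst) D)) = length (concat D)"
      by (simp flip: map_concat)
    then show ?thesis
      using length_concat_tableau[OF that] by (simp only: letters_sentence_of letters_def[of C])
  qed
  have fin: "finite {J :: 'a sentence. letters J = letters C}"
    by (rule finite_subset[OF _ finite_letters_le[of "letters C"]]) auto
  have "(H C :: ('a, 'k) nsym) = (\<Sum>D \<in> ?S. immaculate_rows D)"
    by (simp add: sum_tableaux_of_type)
  also have "\<dots> = (\<Sum>D \<in> ?S. immaculate (?shape D))"
    by (intro sum.cong) (simp_all add: imm)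
  \<comment> \<open>Every tableau of type \<open>C\<close> has as many boxes as \<open>C\<close> has
    letters, so grouping by shape loses none. Inside a group the summand is constant, and the size
    of the group is \<open>K J C\<close>.\<close>
  also have "\<dots> = (\<Sum>J \<in> {J. letters J = letters C}. \<Sum>D \<in> {D \<in> ?S. ?shape D = J}. immaculate (?shape D))"
    using letters by (intro sum.group[symmetric] finite_tableaux_of_type fin) auto
  also have "\<dots> = (\<Sum>J \<in> {J. letters J = letters C}. of_nat (K J C) * immaculate J)"
    by (simp add: K_eq_card)
  finally show ?thesis .
qed

end
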